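(* Consider the deterministic control problem described in the context, and assume all of its standing assumptions (1)--(6). Assume moreover that: (a) (uniform convexity of the mirror map) there exists $\sigma_h>0$ such that $D_h(v\mid u)\ge \frac{\sigma_h}{2}|v-u|^2$ for all $u,v\in U$; (b) (convexity of the control problem) $g$ is convex, and for each $t\in[0,T]$ and $p\in\mathbb{R}^d$ the map $(x,u)\mapsto \mathcal{H}_t^0(x,p,u)$ is concave on $\mathbb{R}^d\times U$. Let $L>0$ be a relative-smoothness constant of $J^\tau$, i.e. a constant such that $J^\tau(v)-J^\tau(u)\le dJ^\tau(u)(v-u)+L\,\mathcal{D}_h(v\mid u)$ for all $u,v\in\mathcal{U}$ (such a constant exists under the standing assumptions and (a)). Let $\lambda\ge L$, let $u^0\in\mathcal{U}$, and let $\{u^n\}_{n\ge 0}$ be the sequence generated by the mirror descent algorithm with parameter $\lambda$ started from $u^0$. (i) If $\tau=0$, then for any $v\in\mathcal{U}$ such that $\mathcal{D}_h(v\mid u^n)<\infty$ for all $n$, $$J^0(u^n)-J^0(v)\le \frac{\lambda}{n}\,\mathcal{D}_h(v\mid u^0),\qquad n\ge 1.$$ (ii) If $\tau>0$ and $u^*$ minimizes $J^\tau$ over $\mathcal{U}$, then $$0\le J^\tau(u^n)-J^\tau(u^* )\le \lambda\Bigl(1-\frac{\tau}{\lambda}\Bigr)^{n-1}\mathcal{D}_h(u^*\mid u^0),\qquad n\ge 1.$$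
   Context: Control problem. Fix $T>0$, $x_0\in\mathbb{R}^d$, $\tau\ge 0$, a set $U\subset\mathbb{R}^m$, and maps $b:[0,T]\times\mathbb{R}^d\times U\to\mathbb{R}^d$, $f:[0,T]\times\mathbb{R}^d\times U\to\mathbb{R}$, $g:\mathbb{R}^d\to\mathbb{R}$, $h:U\to\mathbb{R}$; write $b_t(x,u)=b(t,x,u)$ and $f_t(x,u)=f(t,x,u)$. The control space is $\mathcal{U}:=C([0,T];U)$. For $u\in\mathcal{U}$ the state $x$ is the solution of $\dot x_t=b_t(x_t,u_t)$ on $[0,T]$ with initial value $x_0$. The cost is $$J^\tau(u)=\int_0^T\bigl(f_t(x_t,u_t)+\tau h(u_t)\bigr)\,dt+g(x_T),$$ and $J^0$ is the same with $\tau=0$. Hamiltonians: $\mathcal{H}_t^0(x,p,u)=p\cdot b_t(x,u)-f_t(x,u)$ and $\mathcal{H}_t^\tau(x,p,u)=\mathcal{H}_t^0(x,p,u)-\tau h(u)$. The adjoint $p$ associated with $u$ (and its state $x$) is the solution of $\dot p_t=-\nabla_x\mathcal{H}_t^0(x_t,p_t,u_t)$, $p_T=-\nabla g(x_T)$. For every $u\in\mathcal{U}$ the state and adjoint exist and are unique under the standing assumptions. Norms: $|\cdot|$ is the Euclidean norm of vectors and the spectral norm of matrices; $\|\cdot\|$ is the operator norm. Standing assumptions: (1) $U$ is a nonempty, closed, convex subset of $\mathbb{R}^m$. (2) $b$ and $f$ are continuous, and there is $M>0$ such that for $\varphi=b,f$: $|\varphi_t(x,u)-\varphi_t(x',u')|\le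 M(|x-x'|+|u-u'|)$ and $|\varphi_t(0,u)|\le M$ for all $t\in[0,T]$, $x,x'\in\mathbb{R}^d$, $u,u'\in U$. (3) For $\varphi=b,f$, $\varphi_t(x,u)$ is twice continuously differentiable in $(x,u)$, and, with the same $M$ (possibly increased), $|\nabla_x\varphi_t(x,u)-\nabla_x\varphi_t(x',u')|\le M(|x-x'|+|u-u'|)$ for all $t,x,x',u,u'$. There are constants $M_{b,uu},M_{f,uu}>0$ with $\|\nabla^2_{uu}b_t(x,u)\|\le M_{b,uu}$ and $\|\nabla^2_{uu}f_t(x,u)\|\le M_{f,uu}$ for all $(t,x,u)$. (Consequently $\nabla_x b,\nabla_u b,\nabla_x f,\nabla_u f$ and $\nabla^2_{xx}b,\nabla^2_{xu}b,\nabla^2_{xx}f,\nabla^2_{xu}f$ are uniformly bounded by $M$.) (4) $g$ is continuously differentiable with $\max\{|g(x)-g(x')|,|\nabla g(x)-\nabla g(x')|\}\le M|x-x'|$ for all $x,x'$, and $|g(0)|\le M$. (5) $h$ is convex and continuously differentiable. (6) There exists $u^*\in\mathcal{U}$ minimizing $J^\tau$ over $\mathcal{U}$. Bregman divergences: $D_h(v\mid u)=h(v)-h(u)-\nabla h(u)\cdot(v-u)$ for $u,v\in U$, and $\mathcal{D}_h(v\mid u)=\int_0^T D_h(v_t\mid u_t)\,dt$ for $u,v\in\mathcal{U}$. Directional derivative: for $u,v\in\mathcal{U}$, $dJ^\tau(u)(v-u):=\lim_{\varepsilon\to0^+}\varepsilon^{-1}\bigl(J^\tau(u+\varepsilon(v-u))-J^\tau(u)\bigr)$;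 under the standing assumptions it exists and equals $-\int_0^T\nabla_u\mathcal{H}_t^\tau(x_t,p_t,u_t)\cdot(v_t-u_t)\,dt$, where $(x,p)$ is the state-adjoint pair of $u$. Mirror descent algorithm (parameter $\lambda>0$, initial guess $u^0\in\mathcal{U}$): for $n=0,1,2,\dots$, let $x^n,p^n$ be the state and adjoint associated with $u^n$, and for every $t\in[0,T]$ let $$u_t^{n+1}\in\arg\max_{v\in U}\Bigl\{\nabla_u\mathcal{H}_t^\tau(x_t^n,p_t^n,u_t^n)\cdot(v-u_t^n)-\lambda D_h(v\mid u_t^n)\Bigr\},$$ where $\nabla_u\mathcal{H}_t^\tau(x,p,u)=\nabla_u b_t(x,u)^\top p-\nabla_u f_t(x,u)-\tau\nabla h(u)$. Under the standing assumptions and uniform convexity of $h$, the maximizer exists, is unique, and $u^n\in\mathcal{U}$ for all $n$. *)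

theory Defs
  imports "HOL-Analysis.Analysis"
begin

text \<open>
  Data of the control problem.  The fields whose names end in \<open>_x\<close>, \<open>_u\<close>, \<open>_grad\<close> are the
  gradients; \<open>standing_assumptions\<close> below requires them to be so.  They are carried as data because
  the control set may have empty interior: a derivative within the set is then not unique, although
  its values on the feasible directions \<open>v - u\<close>, with \<open>u\<close>, \<open>v\<close> in the control set, are.
\<close>

record ('d::finite, 'm::finite) control_problem =
  horizon :: real                                               (* T *)
  x_init :: "real^'d"                                           (* x_0 *)
  ctrl_set :: "(real^'m) set"                                   (* U *)
  drift :: "real \<Rightarrow> real^'d \<Rightarrow> real^'m \<Rightarrow> real^'d"           (* b *)
  drift_x :: "real \<Rightarrow> real^'d \<Rightarrow> real^'m \<Rightarrow> real^'d^'d"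
  drift_u :: "real \<Rightarrow> real^'d \<Rightarrow> real^'m \<Rightarrow> real^'m^'d"
  rcost :: "real \<Rightarrow> real^'d \<Rightarrow> real^'m \<Rightarrow> real"               (* f *)
  rcost_x :: "real \<Rightarrow> real^'d \<Rightarrow> real^'m \<Rightarrow> real^'d"
  rcost_u :: "real \<Rightarrow> real^'d \<Rightarrow> real^'m \<Rightarrow> real^'m"
  tcost :: "real^'d \<Rightarrow> real"                                    (* g *)
  tcost_grad :: "real^'d \<Rightarrow> real^'d"
  mirror :: "real^'m \<Rightarrow> real"                                   (* h *)
  mirror_grad :: "real^'m \<Rightarrow> real^'m"

text \<open>Controls, states and adjoints are functions on all of \<open>real\<close>; only their values on
  \<open>{0..T}\<close> matter.\<close>

definition controls :: "('d::finite, 'm::finite) control_problem \<Rightarrow> (real \<Rightarrow> real^'m) set" where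
  "controls P = {u. continuous_on {0..horizon P} u \<and> (\<forall>t\<in>{0..horizon P}. u t \<in> ctrl_set P)}"

definition is_state ::
  "('d::finite, 'm::finite) control_problem \<Rightarrow> (real \<Rightarrow> real^'m) \<Rightarrow> (real \<Rightarrow> real^'d) \<Rightarrow> bool" where
  "is_state P u x \<longleftrightarrow> x 0 = x_init P \<and>
     (\<forall>t\<in>{0..horizon P}.
        (x has_vector_derivative drift P t (x t) (u t)) (at t within {0..horizon P}))"

definition state ::
  "('d::finite, 'm::finite) control_problem \<Rightarrow> (real \<Rightarrow> real^'m) \<Rightarrow> real \<Rightarrow> real^'d" where
  "state P u = (SOME x. is_state P u x)"

definition cost ::
  "('d::finite, 'm::finite) control_problem \<Rightarrow> real \<Rightarrow> (real \<Rightarrow> real^'m) \<Rightarrow> real" where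
  "cost P \<tau> u =
     integral {0..horizon P} (\<lambda>t. rcost P t (state P u t) (u t) + \<tau> * mirror P (u t))
       + tcost P (state P u (horizon P))"

definition ham0 ::
  "('d::finite, 'm::finite) control_problem \<Rightarrow> real \<Rightarrow> real^'d \<Rightarrow> real^'d \<Rightarrow> real^'m \<Rightarrow> real" where
  "ham0 P t x p u = p \<bullet> drift P t x u - rcost P t x u"

definition ham0_x ::
  "('d::finite, 'm::finite) control_problem \<Rightarrow> real \<Rightarrow> real^'d \<Rightarrow> real^'d \<Rightarrow> real^'m \<Rightarrow> real^'d" where
  "ham0_x P t x p u = transpose (drift_x P t x u) *v p - rcost_x P t x u"

definition ham_u ::
  "('d::finite, 'm::finite) control_problem \<Rightarrow> real \<Rightarrow> real \<Rightarrow> real^'d \<Rightarrow> real^'d \<Rightarrow> real^'m \<Rightarrow> real^'m"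
where
  "ham_u P \<tau> t x p u =
     transpose (drift_u P t x u) *v p - rcost_u P t x u - \<tau> *\<^sub>R mirror_grad P u"

definition is_costate ::
  "('d::finite, 'm::finite) control_problem \<Rightarrow> (real \<Rightarrow> real^'m) \<Rightarrow> (real \<Rightarrow> real^'d) \<Rightarrow> bool" where
  "is_costate P u p \<longleftrightarrow> p (horizon P) = - tcost_grad P (state P u (horizon P)) \<and>
     (\<forall>t\<in>{0..horizon P}.
        (p has_vector_derivative - ham0_x P t (state P u t) (p t) (u t)) (at t within {0..horizon P}))"

definition costate ::
  "('d::finite, 'm::finite) control_problem \<Rightarrow> (real \<Rightarrow> real^'m) \<Rightarrow> real \<Rightarrow> real^'d" where
  "costate P u = (SOME p. is_costate P u p)"

definition bregman ::
  "('d::finite, 'm::finite) control_problem \<Rightarrow> real^'m \<Rightarrow> real^'m \<Rightarrow> real" where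
  "bregman P v u = mirror P v - mirror P u - mirror_grad P u \<bullet> (v - u)"

definition int_bregman ::
  "('d::finite, 'm::finite) control_problem \<Rightarrow> (real \<Rightarrow> real^'m) \<Rightarrow> (real \<Rightarrow> real^'m) \<Rightarrow> real" where
  "int_bregman P v u = integral {0..horizon P} (\<lambda>t. bregman P (v t) (u t))"

text \<open>The integral above is real valued, so its finiteness is expressed through the Lebesgue
  integral in the extended nonnegative reals (the integrand is nonnegative for convex \<open>mirror P\<close>).\<close>

definition int_bregman_finite ::
  "('d::finite, 'm::finite) control_problem \<Rightarrow> (real \<Rightarrow> real^'m) \<Rightarrow> (real \<Rightarrow> real^'m) \<Rightarrow> bool" where
  "int_bregman_finite P v u \<longleftrightarrow>
     (\<integral>\<^sup>+t\<in>{0..horizon P}. ennreal (bregman P (v t) (u t)) \<partial>lborel) < \<infinity>"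

text \<open>\<open>dir_deriv P \<tau> u v\<close> is the derivative of the cost at \<open>u\<close> in the direction \<open>v - u\<close>.\<close>

definition dir_deriv ::
  "('d::finite, 'm::finite) control_problem \<Rightarrow> real \<Rightarrow> (real \<Rightarrow> real^'m) \<Rightarrow> (real \<Rightarrow> real^'m) \<Rightarrow> real"
where
  "dir_deriv P \<tau> u v =
     Lim (at_right 0) (\<lambda>\<epsilon>. (cost P \<tau> (\<lambda>t. u t + \<epsilon> *\<^sub>R (v t - u t)) - cost P \<tau> u) / \<epsilon>)"

definition relatively_smooth ::
  "('d::finite, 'm::finite) control_problem \<Rightarrow> real \<Rightarrow> real \<Rightarrow> bool" where
  "relatively_smooth P \<tau> L \<longleftrightarrow>
     (\<forall>u\<in>controls P. \<forall>v\<in>controls P.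
        cost P \<tau> v - cost P \<tau> u \<le> dir_deriv P \<tau> u v + L * int_bregman P v u)"

definition minimizer ::
  "('d::finite, 'm::finite) control_problem \<Rightarrow> real \<Rightarrow> (real \<Rightarrow> real^'m) \<Rightarrow> bool" where
  "minimizer P \<tau> w \<longleftrightarrow> w \<in> controls P \<and> (\<forall>u\<in>controls P. cost P \<tau> w \<le> cost P \<tau> u)"

definition mirror_descent ::
  "('d::finite, 'm::finite) control_problem \<Rightarrow> real \<Rightarrow> real \<Rightarrow> (real \<Rightarrow> real^'m)
     \<Rightarrow> (nat \<Rightarrow> real \<Rightarrow> real^'m) \<Rightarrow> bool" where
  "mirror_descent P \<tau> lam u0 u \<longleftrightarrow> u 0 = u0 \<and>
     (\<forall>n. \<forall>t\<in>{0..horizon P}.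
        is_arg_max
          (\<lambda>v. ham_u P \<tau> t (state P (u n) t) (costate P (u n) t) (u n t) \<bullet> (v - u n t)
                 - lam * bregman P v (u n t))
          (\<lambda>v. v \<in> ctrl_set P)
          (u (Suc n) t))"

definition C1_on ::
  "'a::real_normed_vector set \<Rightarrow> ('a \<Rightarrow> 'b::real_normed_vector) \<Rightarrow> ('a \<Rightarrow> 'a \<Rightarrow>\<^sub>L 'b) \<Rightarrow> bool" where
  "C1_on S F D \<longleftrightarrow>
     (\<forall>z\<in>S. (F has_derivative blinfun_apply (D z)) (at z within S)) \<and> continuous_on S D"

definition lipschitz_growth ::
  "('d::finite, 'm::finite) control_problem \<Rightarrow> real \<Rightarrow>
     (real \<Rightarrow> real^'d \<Rightarrow> real^'m \<Rightarrow> 'a::real_normed_vector) \<Rightarrow> bool" where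
  "lipschitz_growth P M \<phi> \<longleftrightarrow>
     (\<forall>t\<in>{0..horizon P}.
        (\<forall>x x'. \<forall>u\<in>ctrl_set P. \<forall>u'\<in>ctrl_set P.
           norm (\<phi> t x u - \<phi> t x' u') \<le> M * (norm (x - x') + norm (u - u'))) \<and>
        (\<forall>u\<in>ctrl_set P. norm (\<phi> t 0 u) \<le> M))"

text \<open>
  In the next two definitions \<open>(\<lambda>(x, u). \<phi> t x u)\<close> is twice continuously differentiable: its first
  derivative is given by the gradient fields, which are themselves \<open>C1_on\<close>.  The norm of a matrix
  \<open>A\<close> in Isabelle is not the spectral norm, whence \<open>onorm ((*v) A)\<close>.  In \<open>regular_drift\<close> the
  second derivative in \<open>u\<close> is the bilinear map \<open>(k, l) \<mapsto> D (x, u) (0, k) *v l\<close>, and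
  the bound on it says that its operator norm is at most \<open>Muu\<close>.
\<close>

definition regular_drift ::
  "('d::finite, 'm::finite) control_problem \<Rightarrow> real \<Rightarrow> real \<Rightarrow> bool" where
  "regular_drift P M Muu \<longleftrightarrow>
     (\<forall>t\<in>{0..horizon P}.
        (\<forall>x. \<forall>u\<in>ctrl_set P.
           ((\<lambda>(x, u). drift P t x u) has_derivative
              (\<lambda>(k, l). drift_x P t x u *v k + drift_u P t x u *v l))
             (at (x, u) within UNIV \<times> ctrl_set P)) \<and>
        (\<exists>D. C1_on (UNIV \<times> ctrl_set P) (\<lambda>(x, u). drift_x P t x u) D) \<and>
        (\<exists>D. C1_on (UNIV \<times> ctrl_set P) (\<lambda>(x, u). drift_u P t x u) D \<and>
           (\<forall>x. \<forall>u\<in>ctrl_set P. \<forall>k l.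
              norm (blinfun_apply (D (x, u)) (0, k) *v l) \<le> Muu * norm k * norm l)) \<and>
        (\<forall>x x'. \<forall>u\<in>ctrl_set P. \<forall>u'\<in>ctrl_set P.
           onorm ((*v) (drift_x P t x u - drift_x P t x' u'))
             \<le> M * (norm (x - x') + norm (u - u'))))"

definition regular_rcost ::
  "('d::finite, 'm::finite) control_problem \<Rightarrow> real \<Rightarrow> real \<Rightarrow> bool" where
  "regular_rcost P M Muu \<longleftrightarrow>
     (\<forall>t\<in>{0..horizon P}.
        (\<forall>x. \<forall>u\<in>ctrl_set P.
           ((\<lambda>(x, u). rcost P t x u) has_derivative
              (\<lambda>(k, l). rcost_x P t x u \<bullet> k + rcost_u P t x u \<bullet> l))
             (at (x, u) within UNIV \<times> ctrl_set P)) \<and>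
        (\<exists>D. C1_on (UNIV \<times> ctrl_set P) (\<lambda>(x, u). rcost_x P t x u) D) \<and>
        (\<exists>D. C1_on (UNIV \<times> ctrl_set P) (\<lambda>(x, u). rcost_u P t x u) D \<and>
           (\<forall>x. \<forall>u\<in>ctrl_set P. onorm (\<lambda>k. blinfun_apply (D (x, u)) (0, k)) \<le> Muu)) \<and>
        (\<forall>x x'. \<forall>u\<in>ctrl_set P. \<forall>u'\<in>ctrl_set P.
           norm (rcost_x P t x u - rcost_x P t x' u') \<le> M * (norm (x - x') + norm (u - u'))))"

definition standing_assumptions ::
  "('d::finite, 'm::finite) control_problem \<Rightarrow> real \<Rightarrow> real \<Rightarrow> real \<Rightarrow> real \<Rightarrow> bool" where
  "standing_assumptions P \<tau> M Mbuu Mfuu \<longleftrightarrow>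
     horizon P > 0 \<and> \<tau> \<ge> 0 \<and> M > 0 \<and> Mbuu > 0 \<and> Mfuu > 0 \<and>
     ctrl_set P \<noteq> {} \<and> closed (ctrl_set P) \<and> convex (ctrl_set P) \<and>
     continuous_on ({0..horizon P} \<times> UNIV \<times> ctrl_set P) (\<lambda>(t, x, u). drift P t x u) \<and>
     continuous_on ({0..horizon P} \<times> UNIV \<times> ctrl_set P) (\<lambda>(t, x, u). rcost P t x u) \<and>
     lipschitz_growth P M (drift P) \<and> lipschitz_growth P M (rcost P) \<and>
     regular_drift P M Mbuu \<and> regular_rcost P M Mfuu \<and>
     (\<forall>x. (tcost P has_derivative (\<lambda>k. tcost_grad P x \<bullet> k)) (at x)) \<and>
     continuous_on UNIV (tcost_grad P) \<and>
     (\<forall>x x'. max \<bar>tcost P x - tcost P x'\<bar> (norm (tcost_grad P x - tcost_grad P x'))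
                \<le> M * norm (x - x')) \<and>
     \<bar>tcost P 0\<bar> \<le> M \<and>
     convex_on (ctrl_set P) (mirror P) \<and>
     (\<forall>u\<in>ctrl_set P.
        (mirror P has_derivative (\<lambda>k. mirror_grad P u \<bullet> k)) (at u within ctrl_set P)) \<and>
     continuous_on (ctrl_set P) (mirror_grad P) \<and>
     (\<exists>w. minimizer P \<tau> w)"

end

theory Submission
  imports Defs
begin

text \<open>
  Pairing the costate of a control \<open>u\<close> with the difference of the states of \<open>v\<close> and \<open>u\<close> gives an
  exact formula for \<open>J v - J u\<close> in which only first-order remainders of the Hamiltonian and of the
  terminal cost appear.  By dominated convergence it identifies the directional derivative, with no
  need for the linearised state equation; when the Hamiltonian is concave and the terminal cost
  convex the remainders have a sign, so \<open>J v - J u \<ge> dJ u (v - u) + \<tau> D(v | u)\<close>.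

  The first-order condition for the maximiser yields the three-point inequality for Bregman
  divergences.  Combined with relative smoothness and the previous inequality it gives
  \<open>J (u (n + 1)) - J v \<le> (\<lambda> - \<tau>) D(v | u n) - \<lambda> D(v | u (n + 1))\<close>, and both rates follow from
  this recursion.
\<close>

section \<open>Ordinary differential equations\<close>

text \<open>Two obstacles shape the proof. \<open>state\<close> and \<open>costate\<close> are
  chosen by \<open>SOME\<close>, so nothing is known about them before existence is proved. And the
  assumptions say nothing directly about how the gradient fields depend on \<open>t\<close>;
  moreover \<open>drift_u\<close> and \<open>rcost_u\<close> are determined only along the span of
  \<open>U - U\<close>. Hence the control gradients enter integrals only through pairings with
  feasible directions, whose continuity in \<open>t\<close> is inherited from \<open>drift\<close>
  and \<open>rcost\<close>.

  The second obstacle returns with the iterates. The arg max is taken separately at each time, so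
  \<open>u (n + 1)\<close> must first be shown to be continuous before its cost and divergences can
  be handled as integrals of continuous functions. Uniform convexity provides this, because it makes
  \<open>mirror_grad\<close> strongly monotone on \<open>U\<close>.\<close>

lemma ode_exists:
  fixes F :: "real \<Rightarrow> 'a::euclidean_space \<Rightarrow> 'a"
  assumes T: "0 \<le> T" and K: "0 < K"
    and cont: "\<And>x. continuous_on {0..T} x \<Longrightarrow> continuous_on {0..T} (\<lambda>t. F t (x t))"
    and lip: "\<And>t x y. t \<in> {0..T} \<Longrightarrow> norm (F t x - F t y) \<le> K * norm (x - y)"
  obtains x where "x 0 = x0"
    "\<And>t. t \<in> {0..T} \<Longrightarrow> (x has_vector_derivative F t (x t)) (at t within {0..T})"
proof -
  \<comment> \<open>Bounded continuous functions live on the whole line. The retraction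
    \<open>c\<close> extends a function on \<open>{0..T}\<close> to it by its end values.\<close>
  define c where "c t = max 0 (min t T)" for t :: real
  have c_in: "c t \<in> {0..T}" for t
    using T by (auto simp: c_def)
  have c_id: "c t = t" if "t \<in> {0..T}" for t
    using that by (auto simp: c_def)
  have c_cont: "continuous_on UNIV c"
    unfolding c_def by (intro continuous_intros)
  \<comment> \<open>The weight \<open>exp (2 * K * t)\<close> makes the Picard operator a contraction on the whole interval, so no
    gluing of local solutions is needed.\<close>
  define X where "X \<psi> t = exp (2 * K * t) *\<^sub>R apply_bcontfun \<psi> t" for \<psi> :: "real \<Rightarrow>\<^sub>C 'a" and t
  have X_cont: "continuous_on {0..T} (\<lambda>s. F s (X \<psi> s))" for \<psi>
    unfolding X_def by (intro cont continuous_intros continuous_on_apply_bcontfun)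
  define G where "G \<psi> t = exp (- 2 * K * t) *\<^sub>R (x0 + integral {0..t} (\<lambda>s. F s (X \<psi> s)))"
    for \<psi> t
  have G_cont: "continuous_on {0..T} (G \<psi>)" for \<psi>
    unfolding G_def
    by (intro continuous_intros indefinite_integral_continuous_1 integrable_continuous_real X_cont)
  have "G \<psi> \<circ> c \<in> bcontfun" for \<psi>
  proof -
    have "continuous_on UNIV (G \<psi> \<circ> c)"
      by (rule continuous_on_compose[OF c_cont]) (auto intro!: continuous_on_subset[OF G_cont] c_in simp del: atLeastAtMost_iff)
    moreover have "bounded (range (G \<psi> \<circ> c))"
      by (rule bounded_subset[OF compact_imp_bounded[OF compact_continuous_image[OF G_cont]]])
         (auto intro!: imageI c_in simp del: atLeastAtMost_iff)
    ultimately show ?thesis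
      by (simp add: bcontfun_def)
  qed
  then have app: "apply_bcontfun (Bcontfun (G \<psi> \<circ> c)) t = G \<psi> (c t)" for \<psi> t
    by (simp add: Bcontfun_inverse)
  have "\<exists>!\<psi>. Bcontfun (G \<psi> \<circ> c) = \<psi>"
  proof (rule banach_fix_type[of "1/2"])
    show "\<forall>\<phi> \<psi>. dist (Bcontfun (G \<phi> \<circ> c)) (Bcontfun (G \<psi> \<circ> c)) \<le> 1/2 * dist \<phi> \<psi>"
    proof (intro allI dist_bound)
      fix \<phi> \<psi> :: "real \<Rightarrow>\<^sub>C 'a" and t0
      define t where "t = c t0"
      have t: "t \<in> {0..T}"
        using c_in t_def by simp
      define d where "d = dist \<phi> \<psi>"
      have int: "(\<lambda>s. F s (X \<xi> s)) integrable_on {0..t}" for \<xi>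
        using t by (intro integrable_continuous_real continuous_on_subset[OF X_cont]) auto
      \<comment> \<open>Integrating the weight produces the factor \<open>1 / (2 * K)\<close>, which
        cancels the Lipschitz constant and leaves the contraction constant
        \<open>1/2\<close>.\<close>
      have exp_int: "((\<lambda>s. K * (exp (2 * K * s) * d)) has_integral
          (exp (2 * K * t) * d / 2 - exp (2 * K * 0) * d / 2)) {0..t}"
        using t by (intro fundamental_theorem_of_calculus)
          (auto intro!: derivative_eq_intros simp: has_real_derivative_iff_has_vector_derivative[symmetric])
      have "norm (integral {0..t} (\<lambda>s. F s (X \<phi> s)) - integral {0..t} (\<lambda>s. F s (X \<psi> s)))
          = norm (integral {0..t} (\<lambda>s. F s (X \<phi> s) - F s (X \<psi> s)))"
        by (simp add: integral_diff int)
      also have "\<dots> \<le> integral {0..t} (\<lambda>s. K * (exp (2 * K * s) * d))"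
      proof (rule integral_norm_bound_integral)
        show "norm (F s (X \<phi> s) - F s (X \<psi> s)) \<le> K * (exp (2 * K * s) * d)" if "s \<in> {0..t}" for s
        proof -
          have "norm (F s (X \<phi> s) - F s (X \<psi> s)) \<le> K * norm (X \<phi> s - X \<psi> s)"
            using that t by (intro lip) auto
          also have "norm (X \<phi> s - X \<psi> s) = exp (2 * K * s) * dist (\<phi> s) (\<psi> s)"
            by (simp add: X_def dist_norm flip: scaleR_diff_right)
          also have "dist (\<phi> s) (\<psi> s) \<le> d"
            unfolding d_def by (rule dist_bounded)
          finally show ?thesis
            using K by simp
        qed
      qed (use exp_int int in \<open>auto intro!: integrable_diff\<close>)
      also have "\<dots> \<le> exp (2 * K * t) * d / 2"
        using integral_unique[OF exp_int] by (simp add: d_def)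
      finally have *: "norm (integral {0..t} (\<lambda>s. F s (X \<phi> s)) - integral {0..t} (\<lambda>s. F s (X \<psi> s)))
          \<le> exp (2 * K * t) * d / 2" .
      have "dist (G \<phi> t) (G \<psi> t) = exp (- 2 * K * t) *
          norm (integral {0..t} (\<lambda>s. F s (X \<phi> s)) - integral {0..t} (\<lambda>s. F s (X \<psi> s)))"
        by (simp add: G_def dist_norm flip: scaleR_diff_right)
      also have "\<dots> \<le> exp (- 2 * K * t) * (exp (2 * K * t) * d / 2)"
        using * by (intro mult_left_mono) auto
      also have "\<dots> = 1/2 * d"
        by (simp add: exp_minus)
      finally show "dist (Bcontfun (G \<phi> \<circ> c) t0) (Bcontfun (G \<psi> \<circ> c) t0) \<le> 1/2 * dist \<phi> \<psi>"
        by (simp add: app t_def d_def)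
    qed
  qed auto
  then obtain \<psi> where \<psi>: "Bcontfun (G \<psi> \<circ> c) = \<psi>"
    by blast
  have X_eq: "X \<psi> t = x0 + integral {0..t} (\<lambda>s. F s (X \<psi> s))" if "t \<in> {0..T}" for t
  proof -
    have "apply_bcontfun \<psi> t = G \<psi> t"
      using app[of \<psi> t] unfolding \<psi> c_id[OF that] .
    then show ?thesis
      by (simp add: X_def[of \<psi> t] G_def exp_minus)
  qed
  show ?thesis
  proof
    show "X \<psi> 0 = x0"
      using X_eq[of 0] T by simp
    fix t assume t: "t \<in> {0..T}"
    have "((\<lambda>t. x0 + integral {0..t} (\<lambda>s. F s (X \<psi> s))) has_vector_derivative F t (X \<psi> t)) (at t within {0..T})"
      by (auto intro!: derivative_eq_intros integral_has_vector_derivative[OF X_cont t])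
    with t X_eq show "(X \<psi> has_vector_derivative F t (X \<psi> t)) (at t within {0..T})"
      by (rule has_vector_derivative_transform)
  qed
qed

text \<open>The integrating factor \<open>exp (- a * s)\<close> turns the inequality into a bound on
  the derivative of \<open>\<phi> s * exp (- a * s)\<close>. Since this factor is at most 1,
  subtracting \<open>c * s\<close> leaves a nonincreasing function that starts at 0.\<close>

lemma gronwall_zero_initial:
  fixes \<phi> :: "real \<Rightarrow> real"
  assumes a: "a \<ge> 0" and c: "c \<ge> 0" and zero: "\<phi> 0 = 0"
    and der: "\<And>t. t \<in> {0..T} \<Longrightarrow> (\<phi> has_vector_derivative \<phi>' t) (at t within {0..T})"
    and le: "\<And>t. t \<in> {0..T} \<Longrightarrow> \<phi>' t \<le> a * \<phi> t + c"
    and t: "t \<in> {0..T}"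
  shows "\<phi> t \<le> c * T * exp (a * T)"
proof -
  define \<psi> where "\<psi> s = \<phi> s * exp (- a * s) - c * s" for s
  have der\<psi>: "(\<psi> has_vector_derivative (\<phi>' s - a * \<phi> s) * exp (- a * s) - c) (at s within {0..t})"
    if "s \<in> {0..t}" for s
  proof -
    have "(\<phi> has_vector_derivative \<phi>' s) (at s within {0..t})"
      using der[of s] that t by (auto intro: has_vector_derivative_within_subset)
    then show ?thesis
      unfolding \<psi>_def has_real_derivative_iff_has_vector_derivative[symmetric]
      by (auto intro!: derivative_eq_intros simp: algebra_simps)
  qed
  have "((\<lambda>s. (\<phi>' s - a * \<phi> s) * exp (- a * s) - c) has_integral (\<psi> t - \<psi> 0)) {0..t}"
    using t by (intro fundamental_theorem_of_calculus der\<psi>) auto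
  moreover have "((\<lambda>s. 0) has_integral 0) {0..t}"
    by simp
  ultimately have "\<psi> t - \<psi> 0 \<le> 0"
  proof (rule has_integral_le)
    fix s assume s: "s \<in> {0..t}"
    have "(\<phi>' s - a * \<phi> s) * exp (- a * s) \<le> c * 1"
      using le[of s] s t a c by (intro mult_mono) auto
    then show "(\<phi>' s - a * \<phi> s) * exp (- a * s) - c \<le> 0"
      by simp
  qed
  then have "\<phi> t * exp (- a * t) \<le> c * t"
    by (simp add: \<psi>_def zero)
  then have "\<phi> t \<le> c * t * exp (a * t)"
    by (simp add: exp_minus field_simps)
  also have "\<dots> \<le> c * T * exp (a * T)"
    using t a c by (intro mult_mono) (auto intro: mult_left_mono)
  finally show ?thesis .
qed

section \<open>Directional derivatives\<close>

text \<open>Convexity keeps the whole segment in \<open>S\<close>, so the chain rule applies to a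
  derivative taken only within \<open>S\<close>. At the endpoints of \<open>{0..1}\<close> the
  result is one-sided, which is what boundary points of the control set allow.\<close>

lemma has_vector_derivative_along_segment:
  fixes F :: "'a::real_normed_vector \<Rightarrow> 'b::real_normed_vector"
  assumes S: "convex S" "z \<in> S" "z + w \<in> S" and r: "r \<in> {0..1}"
    and F: "(F has_derivative D) (at (z + r *\<^sub>R w) within S)"
  shows "((\<lambda>r. F (z + r *\<^sub>R w)) has_vector_derivative D w) (at r within {0..1})"
proof -
  have sub: "(\<lambda>r. z + r *\<^sub>R w) ` {0..1} \<subseteq> S"
  proof safe
    fix s :: real assume "s \<in> {0..1}"
    then have "(1 - s) *\<^sub>R z + s *\<^sub>R (z + w) \<in> S"
      using S by (intro convexD_alt) auto
    then show "z + s *\<^sub>R w \<in> S"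
      by (simp add: algebra_simps)
  qed
  have "((\<lambda>r. z + r *\<^sub>R w) has_derivative (\<lambda>h. h *\<^sub>R w)) (at r within {0..1})"
    by (auto intro!: derivative_eq_intros)
  from has_derivative_in_compose[OF this has_derivative_subset[OF F sub]]
  have "((\<lambda>r. F (z + r *\<^sub>R w)) has_derivative (\<lambda>h. D (h *\<^sub>R w))) (at r within {0..1})" .
  moreover have "linear D"
    using F by (rule has_derivative_linear)
  ultimately show ?thesis
    by (simp add: has_vector_derivative_def linear_scale)
qed

lemma tendsto_segment_quotient:
  fixes F :: "'a::real_normed_vector \<Rightarrow> 'b::real_normed_vector"
  assumes S: "convex S" "z \<in> S" "w \<in> S" and F: "(F has_derivative D) (at z within S)"
  shows "((\<lambda>r. (F (z + r *\<^sub>R (w - z)) - F z) /\<^sub>R r) \<longlongrightarrow> D (w - z)) (at_right 0)"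
proof -
  have "((\<lambda>r. F (z + r *\<^sub>R (w - z))) has_vector_derivative D (w - z)) (at 0 within {0..1})"
    using S F by (intro has_vector_derivative_along_segment[where S = S]) auto
  then have "((\<lambda>r. (1 / norm (r - 0)) *\<^sub>R (F (z + r *\<^sub>R (w - z)) - (F (z + 0 *\<^sub>R (w - z)) + (r - 0) *\<^sub>R D (w - z))))
      \<longlongrightarrow> 0) (at_right 0)"
    unfolding has_vector_derivative_def has_derivative_within by (simp add: at_within_Icc_at_right)
  moreover have "\<forall>\<^sub>F r in at_right 0.
      (1 / norm (r - 0)) *\<^sub>R (F (z + r *\<^sub>R (w - z)) - (F (z + 0 *\<^sub>R (w - z)) + (r - 0) *\<^sub>R D (w - z)))
      = (F (z + r *\<^sub>R (w - z)) - F z) /\<^sub>R r - D (w - z)"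
    unfolding eventually_at_right_field by (intro exI[of _ 1]) (auto simp: algebra_simps divide_inverse)
  ultimately have "((\<lambda>r. (F (z + r *\<^sub>R (w - z)) - F z) /\<^sub>R r - D (w - z)) \<longlongrightarrow> 0) (at_right 0)"
    by (rule Lim_transform_eventually)
  then show ?thesis
    by (rule LIM_zero_cancel)
qed

text \<open>Concavity bounds every difference quotient along the segment from below by
  \<open>F w - F z\<close>, and the bound survives the one-sided limit.\<close>

lemma concave_on_le_gradient:
  fixes F :: "'a::real_normed_vector \<Rightarrow> real"
  assumes conc: "concave_on S F" and D: "(F has_derivative D) (at z within S)"
    and z: "z \<in> S" and w: "w \<in> S"
  shows "F w - F z \<le> D (w - z)"
proof (rule tendsto_lowerbound)
  have S: "convex S"
    using conc by (simp add: concave_on_def convex_on_def)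
  show "((\<lambda>r. (F (z + r *\<^sub>R (w - z)) - F z) /\<^sub>R r) \<longlongrightarrow> D (w - z)) (at_right 0)"
    by (rule tendsto_segment_quotient[OF S z w D])
  have "F w - F z \<le> (F (z + r *\<^sub>R (w - z)) - F z) /\<^sub>R r" if "r > 0" "r < 1" for r
  proof -
    have "(1 - r) * F z + r * F w \<le> F ((1 - r) *\<^sub>R z + r *\<^sub>R w)"
      using conc that z w unfolding concave_on_iff by auto
    then show ?thesis
      using that by (simp add: field_simps)
  qed
  then show "\<forall>\<^sub>F r in at_right 0. F w - F z \<le> (F (z + r *\<^sub>R (w - z)) - F z) /\<^sub>R r"
    unfolding eventually_at_right_field by (intro exI[of _ 1]) auto
qed auto

text \<open>Once the linear part is removed, the derivative is at most \<open>C * s\<close> on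
  \<open>{0..s}\<close>; the mean value inequality contributes the second factor
  \<open>s\<close>.\<close>

lemma taylor_remainder_bound:
  fixes \<gamma> :: "real \<Rightarrow> 'a::real_normed_vector"
  assumes der: "\<And>r. r \<in> {0..1} \<Longrightarrow> (\<gamma> has_vector_derivative \<gamma>' r) (at r within {0..1})"
    and lip: "\<And>r. r \<in> {0..1} \<Longrightarrow> norm (\<gamma>' r - \<gamma>' 0) \<le> C * r"
    and s: "s \<in> {0..1}"
  shows "norm (\<gamma> s - \<gamma> 0 - s *\<^sub>R \<gamma>' 0) \<le> C * s * s"
proof -
  have C: "C \<ge> 0"
    using lip[of 1] norm_ge_zero[of "\<gamma>' 1 - \<gamma>' 0"] by (simp del: norm_ge_zero)
  have "norm ((\<gamma> s - s *\<^sub>R \<gamma>' 0) - (\<gamma> 0 - 0 *\<^sub>R \<gamma>' 0)) \<le> C * s * norm (s - 0)"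
  proof (rule differentiable_bound[where S = "{0..s}" and f' = "\<lambda>r h. h *\<^sub>R (\<gamma>' r - \<gamma>' 0)"])
    fix r assume r: "r \<in> {0..s}"
    have "(\<gamma> has_vector_derivative \<gamma>' r) (at r within {0..s})"
      using der[of r] r s by (auto intro: has_vector_derivative_within_subset)
    then show "((\<lambda>r. \<gamma> r - r *\<^sub>R \<gamma>' 0) has_derivative (\<lambda>h. h *\<^sub>R (\<gamma>' r - \<gamma>' 0))) (at r within {0..s})"
      by (auto simp: has_vector_derivative_def scaleR_diff_right intro!: derivative_eq_intros)
    have "norm (\<gamma>' r - \<gamma>' 0) \<le> C * s"
      using lip[of r] r s C by (smt (verit) atLeastAtMost_iff mult_left_mono)
    then show "onorm (\<lambda>h. h *\<^sub>R (\<gamma>' r - \<gamma>' 0)) \<le> C * s"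
      by (intro onorm_le) (simp add: mult.commute[of "\<bar>_\<bar>"] mult_right_mono)
  qed (use s in auto)
  then show ?thesis
    using s by (simp add: algebra_simps)
qed

text \<open>The bound on second-order increments, uniform in \<open>t\<close>, makes the directional derivative a uniform
  limit of difference quotients.  It supplies the continuity in \<open>t\<close> of the gradients, which the
  standing assumptions do not state.\<close>

lemma continuous_on_directional_derivative:
  fixes \<gamma> :: "'b::topological_space \<Rightarrow> real \<Rightarrow> 'a::real_normed_vector"
  assumes cont: "\<And>r. r \<in> {0..1} \<Longrightarrow> continuous_on S (\<lambda>t. \<gamma> t r)"
    and der: "\<And>t r. t \<in> S \<Longrightarrow> r \<in> {0..1} \<Longrightarrow> (\<gamma> t has_vector_derivative \<gamma>' t r) (at r within {0..1})"
    and lip: "\<And>t r. t \<in> S \<Longrightarrow> r \<in> {0..1} \<Longrightarrow> norm (\<gamma>' t r - \<gamma>' t 0) \<le> C * r"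
  shows "continuous_on S (\<lambda>t. \<gamma>' t 0)"
proof (rule uniform_limit_theorem)
  let ?q = "\<lambda>r t. (\<gamma> t r - \<gamma> t 0) /\<^sub>R r"
  show "\<forall>\<^sub>F r in at_right 0. continuous_on S (?q r)"
    unfolding eventually_at_right_field
    by (intro exI[of _ 1]) (auto intro!: continuous_intros cont)
  have "norm (?q r t - \<gamma>' t 0) \<le> C * r" if "t \<in> S" "0 < r" "r < 1" for r t
  proof -
    have "?q r t - \<gamma>' t 0 = (\<gamma> t r - \<gamma> t 0 - r *\<^sub>R \<gamma>' t 0) /\<^sub>R r"
      using that by (simp add: algebra_simps)
    then have "norm (?q r t - \<gamma>' t 0) = norm (\<gamma> t r - \<gamma> t 0 - r *\<^sub>R \<gamma>' t 0) / r"
      using that by (simp add: divide_inverse)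
    also have "\<dots> \<le> C * r * r / r"
      using that by (intro divide_right_mono taylor_remainder_bound der lip) auto
    finally show ?thesis
      using that by simp
  qed
  then have "\<forall>\<^sub>F r in at_right 0. \<forall>t\<in>S. norm (?q r t - \<gamma>' t 0) \<le> C * r"
    unfolding eventually_at_right_field by (intro exI[of _ 1]) auto
  moreover have "((\<lambda>r. C * r) \<longlongrightarrow> C * 0) (at_right 0)"
    by (intro tendsto_intros)
  ultimately show "uniform_limit S ?q (\<lambda>t. \<gamma>' t 0) (at_right 0)"
    using order_tendstoD(2)[of "\<lambda>r. C * r" "C * 0" "at_right 0"]
    by (intro uniform_limitI) (force simp: dist_norm elim: eventually_elim2)
qed auto

text \<open>The points \<open>zs n\<close> may approach \<open>z\<close> along a curve. This is the
  situation for pairs of perturbed state and control, where the state does not move affinely with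
  the step; only a distance of the order of the step enters.\<close>

lemma derivative_remainder_quotient:
  fixes F :: "'a::real_normed_vector \<Rightarrow> real"
  assumes F: "(F has_derivative D) (at z within S)" and zs: "\<And>n. zs n \<in> S"
    and le: "\<And>n. norm (zs n - z) \<le> C * \<epsilon> n" and pos: "\<And>n. \<epsilon> n > 0" and lim: "\<epsilon> \<longlonglongrightarrow> 0"
  shows "(\<lambda>n. (F (zs n) - F z - D (zs n - z)) / \<epsilon> n) \<longlonglongrightarrow> 0"
proof (rule LIMSEQ_I)
  fix e :: real assume e: "e > 0"
  have C: "C \<ge> 0"
    using le[of 0] pos[of 0] by (smt (verit) norm_ge_zero zero_le_mult_iff)
  \<comment> \<open>The summand 1 keeps the denominator positive when \<open>C = 0\<close>; the
    factor 1/2 makes the final inequality strict.\<close>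
  define e' where "e' = e / (C + 1) / 2"
  have "e' > 0"
    using e C by (simp add: e'_def)
  then obtain d where d: "d > 0" and
    D: "\<And>y. y \<in> S \<Longrightarrow> norm (y - z) < d \<Longrightarrow> norm (F y - F z - D (y - z)) \<le> e' * norm (y - z)"
    using F unfolding has_derivative_within_alt by blast
  have "(\<lambda>n. C * \<epsilon> n) \<longlonglongrightarrow> C * 0"
    by (intro tendsto_intros lim)
  then obtain N where N: "\<And>n. n \<ge> N \<Longrightarrow> C * \<epsilon> n < d"
    using order_tendstoD(2)[of "\<lambda>n. C * \<epsilon> n" "C * 0" sequentially d] d
    by (auto simp: eventually_sequentially)
  show "\<exists>N. \<forall>n\<ge>N. norm ((F (zs n) - F z - D (zs n - z)) / \<epsilon> n - 0) < e"
  proof (intro exI[of _ N] allI impI)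
    fix n assume n: "n \<ge> N"
    have "norm (F (zs n) - F z - D (zs n - z)) \<le> e' * norm (zs n - z)"
      using N[OF n] le[of n] by (intro D zs) auto
    also have "\<dots> \<le> e' * (C * \<epsilon> n)"
      using le[of n] \<open>e' > 0\<close> by simp
    also have "\<dots> < e * \<epsilon> n"
    proof -
      have "C / (C + 1) / 2 < 1"
        using C by (simp add: field_simps)
      then have "(e * \<epsilon> n) * (C / (C + 1) / 2) < (e * \<epsilon> n) * 1"
        using e pos[of n] by (intro mult_strict_left_mono) auto
      then show ?thesis
        by (simp add: e'_def mult_ac)
    qed
    finally show "norm ((F (zs n) - F z - D (zs n - z)) / \<epsilon> n - 0) < e"
      using pos[of n] by (simp add: field_simps)
  qed
qed

lemma norm_increment_le:
  fixes \<gamma> :: "real \<Rightarrow> 'a::real_normed_vector"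
  assumes der: "\<And>r. r \<in> {0..1} \<Longrightarrow> (\<gamma> has_vector_derivative \<gamma>' r) (at r within {0..1})"
    and bound: "\<And>r. r \<in> {0..1} \<Longrightarrow> norm (\<gamma>' r) \<le> C" and s: "s \<in> {0..1}"
  shows "norm (\<gamma> s - \<gamma> 0) \<le> C * s"
proof -
  have "norm (\<gamma> s - \<gamma> 0) \<le> C * norm (s - 0)"
  proof (rule differentiable_bound[where S = "{0..1}" and f' = "\<lambda>r h. h *\<^sub>R \<gamma>' r"])
    show "onorm (\<lambda>h. h *\<^sub>R \<gamma>' r) \<le> C" if "r \<in> {0..1}" for r
      using bound[OF that] by (intro onorm_le) (simp add: mult.commute[of "\<bar>_\<bar>"] mult_right_mono)
  qed (use s der in \<open>auto simp: has_vector_derivative_def\<close>)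
  then show ?thesis
    using s by simp
qed

lemma continuous_on_interval_bounded:
  fixes f :: "real \<Rightarrow> 'a::real_normed_vector"
  assumes "continuous_on {a..b} f"
  obtains K where "K \<ge> 0" "\<And>t. t \<in> {a..b} \<Longrightarrow> norm (f t) \<le> K"
  using compact_imp_bounded[OF compact_continuous_image[OF assms]]
  by (auto simp: bounded_pos dest: less_imp_le)

section \<open>Linear algebra: matrix products, convex combinations and transposes\<close>

lemma bounded_linear_matrix_vector_mult_left: "bounded_linear (\<lambda>A :: real^'n::finite^'m::finite. A *v l)"
  by (simp add: linear_conv_bounded_linear[symmetric] linear_iff matrix_vector_mult_add_rdistrib scaleR_matrix_vector_assoc)

lemma convex_comb_eq:
  fixes a b :: "'a::real_vector"
  shows "a + r *\<^sub>R (b - a) = (1 - r) *\<^sub>R a + r *\<^sub>R b"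
  by (simp add: algebra_simps)

lemma transpose_mult_inner: "(transpose A *v p) \<bullet> k = p \<bullet> (A *v k)" for A :: "real^'n::finite^'m::finite"
  by (metis dot_lmul_matrix transpose_matrix_vector)

text \<open>Pairing \<open>transpose A *v p\<close> with itself moves \<open>A\<close> to the other
  factor, so a spectral bound passes to the transpose. This serves the adjoint equation.\<close>

lemma norm_transpose_mult_le:
  fixes A :: "real^'n::finite^'m::finite"
  assumes "\<And>k. norm (A *v k) \<le> M * norm k"
  shows "norm (transpose A *v p) \<le> M * norm p"
proof -
  define w where "w = transpose A *v p"
  have "norm w * norm w = p \<bullet> (A *v w)"
    by (metis w_def transpose_mult_inner norm_eq_sqrt_inner real_sqrt_mult_self abs_of_nonneg inner_ge_zero)
  also have "\<dots> \<le> norm p * (M * norm w)"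
    using norm_cauchy_schwarz[of p "A *v w"] assms[of w] by (smt (verit) mult_left_mono norm_ge_zero)
  finally have "norm w * norm w \<le> (M * norm p) * norm w"
    by (simp add: mult_ac)
  moreover have "0 \<le> M * norm p"
  proof -
    \<comment> \<open>The sign of \<open>M\<close> is read off a unit vector along an arbitrary
      coordinate.\<close>
    have "0 \<le> M * norm (axis undefined 1 :: real^'n)"
      using assms[of "axis undefined 1"] by (smt (verit) norm_ge_zero)
    then show ?thesis
      by simp
  qed
  ultimately show ?thesis
    unfolding w_def[symmetric] by (cases "norm w = 0") (auto dest: mult_right_le_imp_le)
qed

section \<open>State and costate\<close>

locale control =
  fixes P :: "('d::finite, 'm::finite) control_problem" and \<tau> M Mbuu Mfuu :: real
  assumes standing: "standing_assumptions P \<tau> M Mbuu Mfuu"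
begin

abbreviation "T \<equiv> horizon P"
abbreviation "U \<equiv> ctrl_set P"

section \<open>The standing assumptions in usable form\<close>

lemma T_pos: "T > 0" and \<tau>_nonneg: "\<tau> \<ge> 0" and M_pos: "M > 0"
  and U_convex: "convex U"
  and drift_cont: "continuous_on ({0..T} \<times> UNIV \<times> U) (\<lambda>(t, x, u). drift P t x u)"
  and rcost_cont: "continuous_on ({0..T} \<times> UNIV \<times> U) (\<lambda>(t, x, u). rcost P t x u)"
  and tcost_deriv: "(tcost P has_derivative (\<lambda>k. tcost_grad P y \<bullet> k)) (at y)"
  and mirror_convex: "convex_on U (mirror P)"
  and mirror_deriv: "a \<in> U \<Longrightarrow>
    (mirror P has_derivative (\<lambda>k. mirror_grad P a \<bullet> k)) (at a within U)"
  and mirror_grad_cont: "continuous_on U (mirror_grad P)"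
  using standing unfolding standing_assumptions_def by simp_all

lemma drift_lipschitz:
  assumes "t \<in> {0..T}" "a \<in> U" "a' \<in> U"
  shows "norm (drift P t x a - drift P t x' a') \<le> M * (norm (x - x') + norm (a - a'))"
  using standing assms unfolding standing_assumptions_def lipschitz_growth_def by simp

lemma rcost_lipschitz:
  assumes "t \<in> {0..T}" "a \<in> U" "a' \<in> U"
  shows "\<bar>rcost P t x a - rcost P t x' a'\<bar> \<le> M * (norm (x - x') + norm (a - a'))"
  using standing assms unfolding standing_assumptions_def lipschitz_growth_def by simp

lemma drift_deriv:
  assumes "t \<in> {0..T}" "a \<in> U"
  shows "((\<lambda>(x, u). drift P t x u) has_derivative
    (\<lambda>(k, l). drift_x P t x a *v k + drift_u P t x a *v l)) (at (x, a) within UNIV \<times> U)"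
  using standing assms unfolding standing_assumptions_def regular_drift_def by blast

lemma rcost_deriv:
  assumes "t \<in> {0..T}" "a \<in> U"
  shows "((\<lambda>(x, u). rcost P t x u) has_derivative
    (\<lambda>(k, l). rcost_x P t x a \<bullet> k + rcost_u P t x a \<bullet> l)) (at (x, a) within UNIV \<times> U)"
  using standing assms unfolding standing_assumptions_def regular_rcost_def by blast

lemma drift_x_lipschitz:
  assumes "t \<in> {0..T}" "a \<in> U" "a' \<in> U"
  shows "onorm ((*v) (drift_x P t x a - drift_x P t x' a')) \<le> M * (norm (x - x') + norm (a - a'))"
  using standing assms unfolding standing_assumptions_def regular_drift_def by blast

lemma rcost_x_lipschitz:
  assumes "t \<in> {0..T}" "a \<in> U" "a' \<in> U"
  shows "norm (rcost_x P t x a - rcost_x P t x' a') \<le> M * (norm (x - x') + norm (a - a'))"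
  using standing assms unfolding standing_assumptions_def regular_rcost_def by blast

lemma drift_u_deriv:
  assumes "t \<in> {0..T}"
  obtains D where
    "\<And>x a. a \<in> U \<Longrightarrow> ((\<lambda>(x, u). drift_u P t x u) has_derivative blinfun_apply (D (x, a)))
       (at (x, a) within UNIV \<times> U)"
    "\<And>x a k l. a \<in> U \<Longrightarrow> norm (blinfun_apply (D (x, a)) (0, k) *v l) \<le> Mbuu * norm k * norm l"
proof -
  have "\<exists>D. C1_on (UNIV \<times> U) (\<lambda>(x, u). drift_u P t x u) D \<and>
           (\<forall>x. \<forall>u\<in>U. \<forall>k l. norm (blinfun_apply (D (x, u)) (0, k) *v l) \<le> Mbuu * norm k * norm l)"
    using standing assms unfolding standing_assumptions_def regular_drift_def by blast
  then show thesis
    using that unfolding C1_on_def by blast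
qed

lemma rcost_u_deriv:
  assumes "t \<in> {0..T}"
  obtains D where
    "\<And>x a. a \<in> U \<Longrightarrow> ((\<lambda>(x, u). rcost_u P t x u) has_derivative blinfun_apply (D (x, a)))
       (at (x, a) within UNIV \<times> U)"
    "\<And>x a k. a \<in> U \<Longrightarrow> norm (blinfun_apply (D (x, a)) (0, k)) \<le> Mfuu * norm k"
proof -
  have "\<exists>D. C1_on (UNIV \<times> U) (\<lambda>(x, u). rcost_u P t x u) D \<and>
           (\<forall>x. \<forall>u\<in>U. onorm (\<lambda>k. blinfun_apply (D (x, u)) (0, k)) \<le> Mfuu)"
    using standing assms unfolding standing_assumptions_def regular_rcost_def by blast
  then obtain D where D: "C1_on (UNIV \<times> U) (\<lambda>(x, u). rcost_u P t x u) D"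
    "\<And>x a. a \<in> U \<Longrightarrow> onorm (\<lambda>k. blinfun_apply (D (x, a)) (0, k)) \<le> Mfuu"
    by blast
  have "norm (blinfun_apply (D (x, a)) (0, k)) \<le> Mfuu * norm k" if "a \<in> U" for x a k
  proof -
    have "bounded_linear (\<lambda>k. blinfun_apply (D (x, a)) (0, k))"
      by (intro bounded_linear_intros) 
    then have "norm (blinfun_apply (D (x, a)) (0, k)) \<le> onorm (\<lambda>k. blinfun_apply (D (x, a)) (0, k)) * norm k"
      by (rule onorm)
    also have "\<dots> \<le> Mfuu * norm k"
      using D(2)[OF that] by (rule mult_right_mono) simp
    finally show ?thesis .
  qed
  with that D(1) show thesis
    unfolding C1_on_def by blast
qed

section \<open>Controls and continuity along trajectories\<close>

lemma controlsD:
  assumes "u \<in> controls P"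
  shows "continuous_on {0..T} u" "t \<in> {0..T} \<Longrightarrow> u t \<in> U"
  using assms by (auto simp: controls_def)

lemma controls_segment:
  assumes "u \<in> controls P" "v \<in> controls P" "r \<in> {0..1}"
  shows "(\<lambda>t. u t + r *\<^sub>R (v t - u t)) \<in> controls P"
  unfolding controls_def
proof (intro CollectI conjI ballI)
  show "continuous_on {0..T} (\<lambda>t. u t + r *\<^sub>R (v t - u t))"
    by (intro continuous_intros controlsD assms)
  show "u t + r *\<^sub>R (v t - u t) \<in> U" if "t \<in> {0..T}" for t
    unfolding convex_comb_eq using assms that by (intro convexD_alt U_convex controlsD) auto
qed

lemma continuous_on_drift:
  assumes "continuous_on {0..T} x" "u \<in> controls P"
  shows "continuous_on {0..T} (\<lambda>t. drift P t (x t) (u t))"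
proof -
  have "continuous_on {0..T} (\<lambda>t. (t, x t, u t))"
    by (intro continuous_intros assms controlsD)
  from continuous_on_compose2[OF drift_cont this] show ?thesis
    using controlsD[OF assms(2)] by (simp add: image_subset_iff)
qed

lemma continuous_on_rcost:
  assumes "continuous_on {0..T} x" "u \<in> controls P"
  shows "continuous_on {0..T} (\<lambda>t. rcost P t (x t) (u t))"
proof -
  have "continuous_on {0..T} (\<lambda>t. (t, x t, u t))"
    by (intro continuous_intros assms controlsD)
  from continuous_on_compose2[OF rcost_cont this] show ?thesis
    using controlsD[OF assms(2)] by (simp add: image_subset_iff)
qed

lemma continuous_on_mirror: "u \<in> controls P \<Longrightarrow> continuous_on {0..T} (\<lambda>t. mirror P (u t))"
  using continuous_on_compose2[of U "mirror P" "{0..T}" u] controlsD[of u]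
    has_derivative_continuous_on[of U "mirror P", OF mirror_deriv] by (simp add: image_subset_iff)

lemma continuous_on_mirror_grad:
  "u \<in> controls P \<Longrightarrow> continuous_on {0..T} (\<lambda>t. mirror_grad P (u t))"
  using continuous_on_compose2[of U "mirror_grad P" "{0..T}" u] controlsD[of u] mirror_grad_cont
  by (simp add: image_subset_iff)

lemma continuous_on_bregman:
  assumes "u \<in> controls P" "v \<in> controls P"
  shows "continuous_on {0..T} (\<lambda>t. bregman P (v t) (u t))"
  unfolding bregman_def
  by (intro continuous_intros continuous_on_mirror continuous_on_mirror_grad controlsD assms)

text \<open>For a fixed control the drift is Lipschitz in the state uniformly in \<open>t\<close>,
  so a solution exists on the whole interval and the choice made by \<open>SOME\<close> is
  one.\<close>

lemma state_is_state:
  assumes u: "u \<in> controls P"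
  shows "is_state P u (state P u)"
proof -
  obtain x where "x 0 = x_init P"
    "\<And>t. t \<in> {0..T} \<Longrightarrow> (x has_vector_derivative drift P t (x t) (u t)) (at t within {0..T})"
  proof (rule ode_exists[of T M "\<lambda>t x. drift P t x (u t)" "x_init P"])
    show "norm (drift P t x (u t) - drift P t y (u t)) \<le> M * norm (x - y)" if "t \<in> {0..T}" for t x y
      using drift_lipschitz[OF that controlsD(2)[OF u that] controlsD(2)[OF u that], of x y] by simp
  qed (use T_pos M_pos u in \<open>auto intro: continuous_on_drift\<close>)
  then have "is_state P u x"
    by (simp add: is_state_def)
  then show ?thesis
    unfolding state_def by (metis someI)
qed

lemma state_init: "u \<in> controls P \<Longrightarrow> state P u 0 = x_init P"
  and state_deriv: "u \<in> controls P \<Longrightarrow> t \<in> {0..T} \<Longrightarrow>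
    (state P u has_vector_derivative drift P t (state P u t) (u t)) (at t within {0..T})"
  using state_is_state by (auto simp: is_state_def)

lemma continuous_on_state: "u \<in> controls P \<Longrightarrow> continuous_on {0..T} (state P u)"
  by (meson continuous_on_eq_continuous_within has_vector_derivative_continuous state_deriv)

text \<open>The Lipschitz bound on \<open>drift\<close> passes to the limit of its difference
  quotients in the state direction \<open>(k, 0)\<close>. It becomes the Lipschitz constant of the
  adjoint equation in the costate.\<close>

lemma norm_drift_x_le:
  assumes t: "t \<in> {0..T}" and a: "a \<in> U"
  shows "norm (drift_x P t x a *v k) \<le> M * norm k"
proof (rule tendsto_upperbound)
  let ?q = "\<lambda>r. (drift P t (x + r *\<^sub>R k) a - drift P t x a) /\<^sub>R r"
  have "(?q \<longlongrightarrow> drift_x P t x a *v k) (at_right 0)"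
    using tendsto_segment_quotient[OF _ _ _ drift_deriv[OF t a, of x], where w = "(x + k, a)"] U_convex a
    by (simp add: convex_Times)
  then show "((\<lambda>r. norm (?q r)) \<longlongrightarrow> norm (drift_x P t x a *v k)) (at_right 0)"
    by (rule tendsto_norm)
  have "norm (?q r) \<le> M * norm k" if "r > 0" for r
    using drift_lipschitz[OF t a a, of "x + r *\<^sub>R k" x] that
    by (simp add: inverse_eq_divide pos_divide_le_eq mult_ac)
  then show "\<forall>\<^sub>F r in at_right 0. norm (?q r) \<le> M * norm k"
    unfolding eventually_at_right_field by (intro exI[of _ 1]) auto
qed auto

text \<open>Continuity in \<open>t\<close> is inherited from \<open>drift\<close> through difference
  quotients in the direction \<open>k\<close>. In the constant, one factor \<open>norm k\<close>
  measures the displacement and the other the vector acted on.\<close>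

lemma continuous_on_drift_x:
  assumes x: "continuous_on {0..T} x" and u: "u \<in> controls P"
  shows "continuous_on {0..T} (\<lambda>t. drift_x P t (x t) (u t) *v k)"
proof -
  have "continuous_on {0..T} (\<lambda>t. drift_x P t (x t + 0 *\<^sub>R k) (u t) *v k)"
  proof (rule continuous_on_directional_derivative[where \<gamma> = "\<lambda>t r. drift P t (x t + r *\<^sub>R k) (u t)"
        and \<gamma>' = "\<lambda>t r. drift_x P t (x t + r *\<^sub>R k) (u t) *v k" and C = "M * norm k * norm k"])
    show "continuous_on {0..T} (\<lambda>t. drift P t (x t + r *\<^sub>R k) (u t))" for r
      by (intro continuous_on_drift continuous_intros x u)
    fix t r :: real assume t: "t \<in> {0..T}" and r: "r \<in> {0..1}"
    note ut = controlsD(2)[OF u t]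
    show "((\<lambda>r. drift P t (x t + r *\<^sub>R k) (u t)) has_vector_derivative
        drift_x P t (x t + r *\<^sub>R k) (u t) *v k) (at r within {0..1})"
      using has_vector_derivative_along_segment[of "UNIV \<times> U" "(x t, u t)" "(k, 0)" r,
          OF _ _ _ r, of "\<lambda>(x, u). drift P t x u"] drift_deriv[OF t ut, of "x t + r *\<^sub>R k"] ut U_convex
      by (fastforce simp: convex_Times)
    have "norm ((drift_x P t (x t + r *\<^sub>R k) (u t) - drift_x P t (x t + 0 *\<^sub>R k) (u t)) *v k)
        \<le> onorm ((*v) (drift_x P t (x t + r *\<^sub>R k) (u t) - drift_x P t (x t + 0 *\<^sub>R k) (u t))) * norm k"
      by (intro onorm matrix_vector_mul_bounded_linear)
    also have "\<dots> \<le> M * norm k * norm k * r"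
      using mult_right_mono[OF drift_x_lipschitz[OF t ut ut, of "x t + r *\<^sub>R k" "x t + 0 *\<^sub>R k"], of "norm k"] r
      by (simp add: mult_ac)
    finally show "norm (drift_x P t (x t + r *\<^sub>R k) (u t) *v k - drift_x P t (x t + 0 *\<^sub>R k) (u t) *v k)
        \<le> M * norm k * norm k * r"
      by (simp add: matrix_vector_mult_diff_rdistrib)
  qed
  then show ?thesis
    by simp
qed

lemma continuous_on_rcost_x:
  assumes x: "continuous_on {0..T} x" and u: "u \<in> controls P"
  shows "continuous_on {0..T} (\<lambda>t. rcost_x P t (x t) (u t) \<bullet> k)"
proof -
  have "continuous_on {0..T} (\<lambda>t. rcost_x P t (x t + 0 *\<^sub>R k) (u t) \<bullet> k)"
  proof (rule continuous_on_directional_derivative[where \<gamma> = "\<lambda>t r. rcost P t (x t + r *\<^sub>R k) (u t)"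
        and \<gamma>' = "\<lambda>t r. rcost_x P t (x t + r *\<^sub>R k) (u t) \<bullet> k" and C = "M * norm k * norm k"])
    show "continuous_on {0..T} (\<lambda>t. rcost P t (x t + r *\<^sub>R k) (u t))" for r
      by (intro continuous_on_rcost continuous_intros x u)
    fix t r :: real assume t: "t \<in> {0..T}" and r: "r \<in> {0..1}"
    note ut = controlsD(2)[OF u t]
    show "((\<lambda>r. rcost P t (x t + r *\<^sub>R k) (u t)) has_vector_derivative
        rcost_x P t (x t + r *\<^sub>R k) (u t) \<bullet> k) (at r within {0..1})"
      using has_vector_derivative_along_segment[of "UNIV \<times> U" "(x t, u t)" "(k, 0)" r,
          OF _ _ _ r, of "\<lambda>(x, u). rcost P t x u"] rcost_deriv[OF t ut, of "x t + r *\<^sub>R k"] ut U_convex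
      by (fastforce simp: convex_Times)
    have "norm ((rcost_x P t (x t + r *\<^sub>R k) (u t) - rcost_x P t (x t + 0 *\<^sub>R k) (u t)) \<bullet> k)
        \<le> norm (rcost_x P t (x t + r *\<^sub>R k) (u t) - rcost_x P t (x t + 0 *\<^sub>R k) (u t)) * norm k"
      using Cauchy_Schwarz_ineq2 by auto
    also have "\<dots> \<le> M * norm k * norm k * r"
      using mult_right_mono[OF rcost_x_lipschitz[OF t ut ut, of "x t + r *\<^sub>R k" "x t + 0 *\<^sub>R k"], of "norm k"] r
      by (simp add: mult_ac)
    finally show "norm (rcost_x P t (x t + r *\<^sub>R k) (u t) \<bullet> k - rcost_x P t (x t + 0 *\<^sub>R k) (u t) \<bullet> k)
        \<le> M * norm k * norm k * r"
      by (simp add: inner_diff_left)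
  qed
  then show ?thesis
    by simp
qed

lemma continuous_on_ham0_x:
  assumes x: "continuous_on {0..T} x" and u: "u \<in> controls P" and p: "continuous_on {0..T} p"
  shows "continuous_on {0..T} (\<lambda>t. ham0_x P t (x t) (p t) (u t))"
proof -
  \<comment> \<open>Pairing with \<open>k\<close> removes the transpose and leaves
    \<open>drift_x\<close> applied to a fixed vector, the form in which continuity is
    available.\<close>
  have "continuous_on {0..T} (\<lambda>t. ham0_x P t (x t) (p t) (u t) \<bullet> k)" for k
    unfolding ham0_x_def inner_diff_left transpose_mult_inner
    by (intro continuous_intros continuous_on_drift_x continuous_on_rcost_x x u p)
  then show ?thesis
    by (subst continuous_on_componentwise) blast
qed

lemma costate_is_costate:
  assumes u: "u \<in> controls P"
  shows "is_costate P u (costate P u)"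
proof -
  note x = continuous_on_state[OF u]
  have refl: "continuous_on {0..T} (\<lambda>s. y (T - s))" if "continuous_on {0..T} y" for y :: "real \<Rightarrow> real^'d"
    by (rule continuous_on_compose2[OF that]) (auto intro!: continuous_intros)
  \<comment> \<open>Reversing time turns the terminal condition into an initial one. The sign of the
    reversal cancels the minus sign of the adjoint equation.\<close>
  define F where "F s q = ham0_x P (T - s) (state P u (T - s)) q (u (T - s))" for s q
  obtain q where q0: "q 0 = - tcost_grad P (state P u T)" and
    q: "\<And>s. s \<in> {0..T} \<Longrightarrow> (q has_vector_derivative F s (q s)) (at s within {0..T})"
  proof (rule ode_exists[of T M F])
    fix q :: "real \<Rightarrow> real^'d" assume q: "continuous_on {0..T} q"
    show "continuous_on {0..T} (\<lambda>s. F s (q s))"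
      using refl[OF continuous_on_ham0_x[OF x u refl[OF q]]] by (simp add: F_def)
  next
    fix s :: real and y z :: "real^'d" assume s: "s \<in> {0..T}"
    then have ut: "T - s \<in> {0..T}" "u (T - s) \<in> U"
      using controlsD(2)[OF u, of "T - s"] by auto
    have "F s y - F s z = transpose (drift_x P (T - s) (state P u (T - s)) (u (T - s))) *v (y - z)"
      by (simp add: F_def ham0_x_def matrix_vector_mult_diff_distrib)
    then show "norm (F s y - F s z) \<le> M * norm (y - z)"
      by (simp only:) (intro norm_transpose_mult_le norm_drift_x_le ut)
  qed (use T_pos M_pos in auto)
  define p where "p t = q (T - t)" for t
  have "(p has_vector_derivative - ham0_x P t (state P u t) (p t) (u t)) (at t within {0..T})"
    if t: "t \<in> {0..T}" for t
  proof -
    have "((\<lambda>t. T - t) has_vector_derivative -1) (at t within {0..T})"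
      by (auto intro!: derivative_eq_intros)
    moreover have "(q has_vector_derivative F (T - t) (q (T - t))) (at (T - t) within (\<lambda>t. T - t) ` {0..T})"
      using q[of "T - t"] t by (simp add: image_diff_atLeastAtMost)
    ultimately have "(q \<circ> (\<lambda>t. T - t) has_vector_derivative (-1) *\<^sub>R F (T - t) (q (T - t))) (at t within {0..T})"
      by (rule vector_diff_chain_within)
    then show ?thesis
      by (simp add: p_def[abs_def] o_def F_def)
  qed
  then have "is_costate P u p"
    by (simp add: is_costate_def p_def q0)
  then show ?thesis
    unfolding costate_def by (metis someI)
qed

lemma costate_final: "u \<in> controls P \<Longrightarrow> costate P u T = - tcost_grad P (state P u T)"
  and costate_deriv: "u \<in> controls P \<Longrightarrow> t \<in> {0..T} \<Longrightarrow>
    (costate P u has_vector_derivative - ham0_x P t (state P u t) (costate P u t) (u t)) (at t within {0..T})"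
  using costate_is_costate by (auto simp: is_costate_def)

lemma continuous_on_costate: "u \<in> controls P \<Longrightarrow> continuous_on {0..T} (costate P u)"
  by (meson continuous_on_eq_continuous_within has_vector_derivative_continuous costate_deriv)

section \<open>Gradient of the Hamiltonian along feasible directions\<close>

text \<open>The state is frozen along the segment, so only the second derivative in the control
  occurs. It is evaluated on \<open>c - a\<close> twice, once as the displacement and once as the
  paired vector, whence the square of the norm.\<close>

lemma drift_u_segment_lipschitz:
  assumes t: "t \<in> {0..T}" and a: "a \<in> U" "c \<in> U" and r: "r \<in> {0..1}"
  shows "norm (drift_u P t x (a + r *\<^sub>R (c - a)) *v (c - a) - drift_u P t x (a + 0 *\<^sub>R (c - a)) *v (c - a))
    \<le> Mbuu * norm (c - a) * norm (c - a) * r"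
proof -
  obtain D where D: "\<And>x a. a \<in> U \<Longrightarrow> ((\<lambda>(x, u). drift_u P t x u) has_derivative blinfun_apply (D (x, a)))
       (at (x, a) within UNIV \<times> U)"
    "\<And>x a k l. a \<in> U \<Longrightarrow> norm (blinfun_apply (D (x, a)) (0, k) *v l) \<le> Mbuu * norm k * norm l"
    using drift_u_deriv[OF t] by blast
  have in_U: "a + s *\<^sub>R (c - a) \<in> U" if "s \<in> {0..1}" for s
    unfolding convex_comb_eq using that a by (intro convexD_alt U_convex) auto
  show ?thesis
  proof (rule norm_increment_le[OF _ _ r])
    fix s :: real assume s: "s \<in> {0..1}"
    have "((\<lambda>s. drift_u P t x (a + s *\<^sub>R (c - a))) has_vector_derivative
        blinfun_apply (D (x, a + s *\<^sub>R (c - a))) (0, c - a)) (at s within {0..1})"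
      using has_vector_derivative_along_segment[of "UNIV \<times> U" "(x, a)" "(0, c - a)" s,
          OF _ _ _ s, of "\<lambda>(x, u). drift_u P t x u"] D(1)[OF in_U[OF s], of x] a U_convex
      by (simp add: convex_Times)
    then show "((\<lambda>s. drift_u P t x (a + s *\<^sub>R (c - a)) *v (c - a)) has_vector_derivative
        blinfun_apply (D (x, a + s *\<^sub>R (c - a))) (0, c - a) *v (c - a)) (at s within {0..1})"
      by (rule bounded_linear.has_vector_derivative[OF bounded_linear_matrix_vector_mult_left])
    show "norm (blinfun_apply (D (x, a + s *\<^sub>R (c - a))) (0, c - a) *v (c - a))
        \<le> Mbuu * norm (c - a) * norm (c - a)"
      by (intro D(2) in_U s)
  qed
qed

lemma rcost_u_segment_lipschitz:
  assumes t: "t \<in> {0..T}" and a: "a \<in> U" "c \<in> U" and r: "r \<in> {0..1}"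
  shows "norm (rcost_u P t x (a + r *\<^sub>R (c - a)) \<bullet> (c - a) - rcost_u P t x (a + 0 *\<^sub>R (c - a)) \<bullet> (c - a))
    \<le> Mfuu * norm (c - a) * norm (c - a) * r"
proof -
  obtain D where D: "\<And>x a. a \<in> U \<Longrightarrow> ((\<lambda>(x, u). rcost_u P t x u) has_derivative blinfun_apply (D (x, a)))
       (at (x, a) within UNIV \<times> U)"
    "\<And>x a k. a \<in> U \<Longrightarrow> norm (blinfun_apply (D (x, a)) (0, k)) \<le> Mfuu * norm k"
    using rcost_u_deriv[OF t] by blast
  have in_U: "a + s *\<^sub>R (c - a) \<in> U" if "s \<in> {0..1}" for s
    unfolding convex_comb_eq using that a by (intro convexD_alt U_convex) auto
  show ?thesis
  proof (rule norm_increment_le[OF _ _ r])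
    fix s :: real assume s: "s \<in> {0..1}"
    have "((\<lambda>s. rcost_u P t x (a + s *\<^sub>R (c - a))) has_vector_derivative
        blinfun_apply (D (x, a + s *\<^sub>R (c - a))) (0, c - a)) (at s within {0..1})"
      using has_vector_derivative_along_segment[of "UNIV \<times> U" "(x, a)" "(0, c - a)" s,
          OF _ _ _ s, of "\<lambda>(x, u). rcost_u P t x u"] D(1)[OF in_U[OF s], of x] a U_convex
      by (simp add: convex_Times)
    then show "((\<lambda>s. rcost_u P t x (a + s *\<^sub>R (c - a)) \<bullet> (c - a)) has_vector_derivative
        blinfun_apply (D (x, a + s *\<^sub>R (c - a))) (0, c - a) \<bullet> (c - a)) (at s within {0..1})"
      by (rule bounded_linear.has_vector_derivative[OF bounded_linear_inner_left])
    show "norm (blinfun_apply (D (x, a + s *\<^sub>R (c - a))) (0, c - a) \<bullet> (c - a))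
        \<le> Mfuu * norm (c - a) * norm (c - a)"
      using Cauchy_Schwarz_ineq2 D(2)[OF in_U[OF s], of x "c - a"]
      by (smt (verit, best) mult_right_mono norm_ge_zero real_norm_def)
  qed
qed

text \<open>Difference quotients are now taken towards \<open>v t\<close>, so the direction itself
  varies with \<open>t\<close>. Compactness of the interval bounds it by \<open>K\<close> and keeps
  the remainder estimate uniform.\<close>

lemma continuous_on_drift_u:
  assumes x: "continuous_on {0..T} x" and u: "u \<in> controls P" and v: "v \<in> controls P"
  shows "continuous_on {0..T} (\<lambda>t. drift_u P t (x t) (u t) *v (v t - u t))"
proof -
  have "continuous_on {0..T} (\<lambda>t. v t - u t)"
    by (intro continuous_intros controlsD u v)
  then obtain K where K: "K \<ge> 0" "\<And>t. t \<in> {0..T} \<Longrightarrow> norm (v t - u t) \<le> K"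
    by (rule continuous_on_interval_bounded) blast
  have Mbuu: "Mbuu > 0"
    using standing by (simp add: standing_assumptions_def)
  have "continuous_on {0..T} (\<lambda>t. drift_u P t (x t) (u t + 0 *\<^sub>R (v t - u t)) *v (v t - u t))"
  proof (rule continuous_on_directional_derivative[where \<gamma> = "\<lambda>t r. drift P t (x t) (u t + r *\<^sub>R (v t - u t))"
        and \<gamma>' = "\<lambda>t r. drift_u P t (x t) (u t + r *\<^sub>R (v t - u t)) *v (v t - u t)" and C = "Mbuu * K * K"])
    show "continuous_on {0..T} (\<lambda>t. drift P t (x t) (u t + r *\<^sub>R (v t - u t)))" if "r \<in> {0..1}" for r
      by (intro continuous_on_drift x controls_segment u v that)
    fix t r :: real assume t: "t \<in> {0..T}" and r: "r \<in> {0..1}"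
    note in_U = controlsD(2)[OF u t] controlsD(2)[OF v t] controlsD(2)[OF controls_segment[OF u v r] t]
    show "((\<lambda>r. drift P t (x t) (u t + r *\<^sub>R (v t - u t))) has_vector_derivative
        drift_u P t (x t) (u t + r *\<^sub>R (v t - u t)) *v (v t - u t)) (at r within {0..1})"
      using has_vector_derivative_along_segment[of "UNIV \<times> U" "(x t, u t)" "(0, v t - u t)" r,
          OF _ _ _ r, of "\<lambda>(x, u). drift P t x u"] drift_deriv[OF t in_U(3), of "x t"] in_U U_convex
      by (fastforce simp: convex_Times)
    have "norm (drift_u P t (x t) (u t + r *\<^sub>R (v t - u t)) *v (v t - u t) -
        drift_u P t (x t) (u t + 0 *\<^sub>R (v t - u t)) *v (v t - u t))
        \<le> Mbuu * norm (v t - u t) * norm (v t - u t) * r"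
      by (intro drift_u_segment_lipschitz t r in_U)
    also have "\<dots> \<le> Mbuu * K * K * r"
      using K Mbuu r t by (intro mult_mono) auto
    finally show "norm (drift_u P t (x t) (u t + r *\<^sub>R (v t - u t)) *v (v t - u t) -
        drift_u P t (x t) (u t + 0 *\<^sub>R (v t - u t)) *v (v t - u t)) \<le> Mbuu * K * K * r" .
  qed
  then show ?thesis
    by simp
qed

lemma continuous_on_rcost_u:
  assumes x: "continuous_on {0..T} x" and u: "u \<in> controls P" and v: "v \<in> controls P"
  shows "continuous_on {0..T} (\<lambda>t. rcost_u P t (x t) (u t) \<bullet> (v t - u t))"
proof -
  have "continuous_on {0..T} (\<lambda>t. v t - u t)"
    by (intro continuous_intros controlsD u v)
  then obtain K where K: "K \<ge> 0" "\<And>t. t \<in> {0..T} \<Longrightarrow> norm (v t - u t) \<le> K"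
    by (rule continuous_on_interval_bounded) blast
  have Mfuu: "Mfuu > 0"
    using standing by (simp add: standing_assumptions_def)
  have "continuous_on {0..T} (\<lambda>t. rcost_u P t (x t) (u t + 0 *\<^sub>R (v t - u t)) \<bullet> (v t - u t))"
  proof (rule continuous_on_directional_derivative[where \<gamma> = "\<lambda>t r. rcost P t (x t) (u t + r *\<^sub>R (v t - u t))"
        and \<gamma>' = "\<lambda>t r. rcost_u P t (x t) (u t + r *\<^sub>R (v t - u t)) \<bullet> (v t - u t)" and C = "Mfuu * K * K"])
    show "continuous_on {0..T} (\<lambda>t. rcost P t (x t) (u t + r *\<^sub>R (v t - u t)))" if "r \<in> {0..1}" for r
      by (intro continuous_on_rcost x controls_segment u v that)
    fix t r :: real assume t: "t \<in> {0..T}" and r: "r \<in> {0..1}"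
    note in_U = controlsD(2)[OF u t] controlsD(2)[OF v t] controlsD(2)[OF controls_segment[OF u v r] t]
    show "((\<lambda>r. rcost P t (x t) (u t + r *\<^sub>R (v t - u t))) has_vector_derivative
        rcost_u P t (x t) (u t + r *\<^sub>R (v t - u t)) \<bullet> (v t - u t)) (at r within {0..1})"
      using has_vector_derivative_along_segment[of "UNIV \<times> U" "(x t, u t)" "(0, v t - u t)" r,
          OF _ _ _ r, of "\<lambda>(x, u). rcost P t x u"] rcost_deriv[OF t in_U(3), of "x t"] in_U U_convex
      by (fastforce simp: convex_Times)
    have "norm (rcost_u P t (x t) (u t + r *\<^sub>R (v t - u t)) \<bullet> (v t - u t) -
        rcost_u P t (x t) (u t + 0 *\<^sub>R (v t - u t)) \<bullet> (v t - u t))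
        \<le> Mfuu * norm (v t - u t) * norm (v t - u t) * r"
      by (intro rcost_u_segment_lipschitz t r in_U)
    also have "\<dots> \<le> Mfuu * K * K * r"
      using K Mfuu r t by (intro mult_mono) auto
    finally show "norm (rcost_u P t (x t) (u t + r *\<^sub>R (v t - u t)) \<bullet> (v t - u t) -
        rcost_u P t (x t) (u t + 0 *\<^sub>R (v t - u t)) \<bullet> (v t - u t)) \<le> Mfuu * K * K * r" .
  qed
  then show ?thesis
    by simp
qed

text \<open>By \<open>dir_deriv_eq\<close>, this is minus the gradient of the cost at
  \<open>u\<close> for the integral pairing with feasible directions.\<close>

definition ham_grad :: "(real \<Rightarrow> real^'m) \<Rightarrow> real \<Rightarrow> real^'m" where
  "ham_grad u t = ham_u P \<tau> t (state P u t) (costate P u t) (u t)"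

text \<open>Only the pairing with feasible directions is continuous: off the span of \<open>U - U\<close> the field
  \<open>drift_u\<close> may depend on \<open>t\<close> arbitrarily.\<close>

lemma continuous_on_ham_grad:
  assumes u: "u \<in> controls P" and v: "v \<in> controls P"
  shows "continuous_on {0..T} (\<lambda>t. ham_grad u t \<bullet> (v t - u t))"
  unfolding ham_grad_def ham_u_def inner_diff_left transpose_mult_inner inner_scaleR_left
  by (intro continuous_intros continuous_on_drift_u continuous_on_rcost_u continuous_on_mirror_grad
      continuous_on_state continuous_on_costate controlsD u v)

section \<open>Nonnegative divergence and stability of the state under changes of control\<close>

lemma bregman_nonneg:
  assumes "a \<in> U" "c \<in> U"
  shows "0 \<le> bregman P c a"
proof -
  have "concave_on U (\<lambda>w. - mirror P w)"
    using mirror_convex by (simp add: concave_on_def)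
  moreover have "((\<lambda>w. - mirror P w) has_derivative (\<lambda>k. - (mirror_grad P a \<bullet> k))) (at a within U)"
    using mirror_deriv[OF assms(1)] by (rule has_derivative_minus)
  ultimately have "- mirror P c - - mirror P a \<le> - (mirror_grad P a \<bullet> (c - a))"
    using assms by (rule concave_on_le_gradient)
  then show ?thesis
    by (simp add: bregman_def)
qed

text \<open>Gronwall is applied to the squared norm, which is differentiable also where the states
  meet. The estimate \<open>2 * norm (z t) * B \<le> (norm (z t))\<^sup>2 + B\<^sup>2\<close> yields
  the rate \<open>3 * M\<close> and the source \<open>M * B\<^sup>2\<close>; the square root makes
  the bound linear in \<open>B\<close> again.\<close>

lemma state_lipschitz:
  assumes u: "u \<in> controls P" and v: "v \<in> controls P" and B: "B \<ge> 0"
    and uv: "\<And>t. t \<in> {0..T} \<Longrightarrow> norm (v t - u t) \<le> B" and t: "t \<in> {0..T}"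
  shows "norm (state P v t - state P u t) \<le> sqrt (M * T * exp (3 * M * T)) * B"
proof -
  define z where "z t = state P v t - state P u t" for t
  define w where "w t = drift P t (state P v t) (v t) - drift P t (state P u t) (u t)" for t
  have "z t \<bullet> z t \<le> (M * B\<^sup>2) * T * exp (3 * M * T)"
  proof (rule gronwall_zero_initial[where \<phi> = "\<lambda>t. z t \<bullet> z t" and \<phi>' = "\<lambda>t. z t \<bullet> w t + w t \<bullet> z t", OF _ _ _ _ _ t])
    fix t assume t: "t \<in> {0..T}"
    have "(z has_vector_derivative w t) (at t within {0..T})"
      unfolding z_def w_def by (intro has_vector_derivative_diff state_deriv u v t)
    from bounded_bilinear.has_vector_derivative[OF bounded_bilinear_inner this this]
    show "((\<lambda>t. z t \<bullet> z t) has_vector_derivative z t \<bullet> w t + w t \<bullet> z t) (at t within {0..T})" .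
    have "norm (w t) \<le> M * (norm (z t) + norm (v t - u t))"
      unfolding w_def z_def by (intro drift_lipschitz controlsD u v t)
    also have "\<dots> \<le> M * (norm (z t) + B)"
      using uv[OF t] M_pos by simp
    finally have w: "norm (w t) \<le> M * (norm (z t) + B)" .
    have "z t \<bullet> w t + w t \<bullet> z t \<le> 2 * (norm (z t) * norm (w t))"
      using norm_cauchy_schwarz[of "z t" "w t"] by (simp add: inner_commute)
    also have "\<dots> \<le> 2 * (norm (z t) * (M * (norm (z t) + B)))"
      using w by (intro mult_left_mono) auto
    also have "\<dots> = M * (2 * (norm (z t))\<^sup>2 + 2 * norm (z t) * B)"
      by (simp add: power2_eq_square algebra_simps)
    also have "\<dots> \<le> M * (3 * (norm (z t))\<^sup>2 + B\<^sup>2)"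
      using M_pos sum_squares_bound[of "norm (z t)" B] by (intro mult_left_mono) auto
    also have "\<dots> = 3 * M * (z t \<bullet> z t) + M * B\<^sup>2"
      by (simp add: power2_norm_eq_inner algebra_simps)
    finally show "z t \<bullet> w t + w t \<bullet> z t \<le> 3 * M * (z t \<bullet> z t) + M * B\<^sup>2" .
  qed (use M_pos state_init u v in \<open>auto simp: z_def\<close>)
  then have "sqrt (z t \<bullet> z t) \<le> sqrt ((M * T * exp (3 * M * T)) * B\<^sup>2)"
    by (intro real_sqrt_le_mono) (simp add: mult_ac)
  then show ?thesis
    using B by (simp add: norm_eq_sqrt_inner z_def real_sqrt_mult)
qed

section \<open>The derivative of the cost\<close>

text \<open>The increment is linearised in the state only. The costate equation accounts for the
  subtracted part, and the control part left inside produces the derivative of the cost.\<close>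

definition ham_rem :: "(real \<Rightarrow> real^'m) \<Rightarrow> (real \<Rightarrow> real^'m) \<Rightarrow> real \<Rightarrow> real" where
  "ham_rem u v t = ham0 P t (state P v t) (costate P u t) (v t) - ham0 P t (state P u t) (costate P u t) (u t)
     - ham0_x P t (state P u t) (costate P u t) (u t) \<bullet> (state P v t - state P u t)"

definition tcost_rem :: "(real \<Rightarrow> real^'m) \<Rightarrow> (real \<Rightarrow> real^'m) \<Rightarrow> real" where
  "tcost_rem u v = tcost P (state P v T) - tcost P (state P u T)
     - tcost_grad P (state P u T) \<bullet> (state P v T - state P u T)"

lemma continuous_on_ham_rem:
  assumes u: "u \<in> controls P" and v: "v \<in> controls P"
  shows "continuous_on {0..T} (ham_rem u v)"
  unfolding ham_rem_def[abs_def] ham0_def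
  by (intro continuous_intros continuous_on_drift continuous_on_rcost continuous_on_ham0_x
      continuous_on_state continuous_on_costate u v)

text \<open>Integrate the derivative of
  \<open>costate P u t \<bullet> (state P v t - state P u t)\<close>. This product vanishes at 0,
  where the states agree, and at \<open>T\<close> it is minus the linear part of the terminal cost.
  No approximation is made.\<close>

lemma cost_difference:
  assumes u: "u \<in> controls P" and v: "v \<in> controls P"
  shows "cost P \<tau> v - cost P \<tau> u =
    tcost_rem u v + integral {0..T} (\<lambda>t. \<tau> * (mirror P (v t) - mirror P (u t)) - ham_rem u v t)"
proof -
  let ?x = "state P u" and ?y = "state P v" and ?p = "costate P u"
  let ?d = "\<lambda>t. ?p t \<bullet> (drift P t (?y t) (v t) - drift P t (?x t) (u t))
      + (- ham0_x P t (?x t) (?p t) (u t)) \<bullet> (?y t - ?x t)"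
  have "(?d has_integral (?p T \<bullet> (?y T - ?x T) - ?p 0 \<bullet> (?y 0 - ?x 0))) {0..T}"
    using T_pos
    by (intro fundamental_theorem_of_calculus bounded_bilinear.has_vector_derivative[OF bounded_bilinear_inner]
        has_vector_derivative_diff costate_deriv state_deriv u v) auto
  then have d: "(?d has_integral (- (tcost_grad P (?x T) \<bullet> (?y T - ?x T)))) {0..T}"
    by (simp add: state_init costate_final u v)
  have run: "((\<lambda>t. rcost P t (state P w t) (w t) + \<tau> * mirror P (w t)) has_integral
      (cost P \<tau> w - tcost P (state P w T))) {0..T}" if w: "w \<in> controls P" for w
    unfolding cost_def add_diff_cancel_right'
    by (intro integrable_integral integrable_continuous_real continuous_intros continuous_on_rcost
        continuous_on_state continuous_on_mirror w)
  have "((\<lambda>t. rcost P t (?y t) (v t) + \<tau> * mirror P (v t) - (rcost P t (?x t) (u t) + \<tau> * mirror P (u t)) - ?d t)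
      has_integral ((cost P \<tau> v - tcost P (?y T)) - (cost P \<tau> u - tcost P (?x T))
        - (- (tcost_grad P (?x T) \<bullet> (?y T - ?x T))))) {0..T}"
    by (intro has_integral_diff run d u v)
  moreover have "rcost P t (?y t) (v t) + \<tau> * mirror P (v t) - (rcost P t (?x t) (u t) + \<tau> * mirror P (u t)) - ?d t
      = \<tau> * (mirror P (v t) - mirror P (u t)) - ham_rem u v t" for t
    unfolding ham_rem_def ham0_def inner_minus_left inner_diff_right right_diff_distrib by linarith
  ultimately have "((\<lambda>t. \<tau> * (mirror P (v t) - mirror P (u t)) - ham_rem u v t) has_integral
      ((cost P \<tau> v - tcost P (?y T)) - (cost P \<tau> u - tcost P (?x T))
        - (- (tcost_grad P (?x T) \<bullet> (?y T - ?x T))))) {0..T}"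
    by (simp only:)
  from integral_unique[OF this] show ?thesis
    unfolding tcost_rem_def by linarith
qed

text \<open>The parameter 0 in \<open>ham_u\<close> drops the mirror term and leaves the control
  gradient of \<open>ham0\<close>.\<close>

lemma ham0_deriv:
  assumes t: "t \<in> {0..T}" and a: "a \<in> U"
  shows "((\<lambda>(x, w). ham0 P t x p w) has_derivative
    (\<lambda>(k, l). ham0_x P t x p a \<bullet> k + ham_u P 0 t x p a \<bullet> l)) (at (x, a) within UNIV \<times> U)"
proof -
  have F: "(\<lambda>(x, w). ham0 P t x p w) =
      (\<lambda>z. p \<bullet> (case z of (x, w) \<Rightarrow> drift P t x w) - (case z of (x, w) \<Rightarrow> rcost P t x w))"
    by (auto simp: ham0_def)
  have D: "(\<lambda>(k, l). ham0_x P t x p a \<bullet> k + ham_u P 0 t x p a \<bullet> l) =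
      (\<lambda>z. p \<bullet> (case z of (k, l) \<Rightarrow> drift_x P t x a *v k + drift_u P t x a *v l)
        - (case z of (k, l) \<Rightarrow> rcost_x P t x a \<bullet> k + rcost_u P t x a \<bullet> l))"
    unfolding ham0_x_def ham_u_def inner_diff_left transpose_mult_inner
    by (auto simp: fun_eq_iff inner_add_right)
  show ?thesis
    unfolding F D
    by (intro has_derivative_diff bounded_linear.has_derivative[OF bounded_linear_inner_right]
        drift_deriv rcost_deriv t a)
qed

lemma ham0_lipschitz:
  assumes t: "t \<in> {0..T}" and a: "a \<in> U" "c \<in> U"
  shows "\<bar>ham0 P t y p c - ham0 P t x p a\<bar> \<le> (norm p + 1) * (M * (norm (y - x) + norm (c - a)))"
proof -
  let ?N = "M * (norm (y - x) + norm (c - a))"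
  have "\<bar>p \<bullet> (drift P t y c - drift P t x a)\<bar> \<le> norm p * norm (drift P t y c - drift P t x a)"
    by (rule Cauchy_Schwarz_ineq2)
  also have "\<dots> \<le> norm p * ?N"
    by (intro mult_left_mono drift_lipschitz t a) auto
  finally have "\<bar>p \<bullet> (drift P t y c - drift P t x a)\<bar> \<le> norm p * ?N" .
  moreover have "\<bar>rcost P t y c - rcost P t x a\<bar> \<le> ?N"
    by (intro rcost_lipschitz t a)
  ultimately show ?thesis
    unfolding ham0_def inner_diff_right distrib_right mult_1 by linarith
qed

text \<open>The assumptions give no global Lipschitz bound for the mirror map. Convexity gives an
  estimate linear in \<open>r\<close>: the chord bounds the increment from above, the tangent from
  below.\<close>

lemma mirror_segment_bound:
  assumes a: "a \<in> U" "c \<in> U" and r: "r \<in> {0..1}"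
  shows "\<bar>mirror P (a + r *\<^sub>R (c - a)) - mirror P a\<bar>
    \<le> r * (\<bar>mirror P c - mirror P a\<bar> + \<bar>mirror_grad P a \<bullet> (c - a)\<bar>)"
proof -
  have in_U: "a + r *\<^sub>R (c - a) \<in> U"
    unfolding convex_comb_eq using r a by (intro convexD_alt U_convex) auto
  have "mirror P (a + r *\<^sub>R (c - a)) \<le> (1 - r) * mirror P a + r * mirror P c"
    unfolding convex_comb_eq using r a by (intro convex_onD[OF mirror_convex]) auto
  then have up: "mirror P (a + r *\<^sub>R (c - a)) - mirror P a \<le> r * (mirror P c - mirror P a)"
    by (simp add: algebra_simps)
  have low: "r * (mirror_grad P a \<bullet> (c - a)) \<le> mirror P (a + r *\<^sub>R (c - a)) - mirror P a"
    using bregman_nonneg[OF a(1) in_U] by (simp add: bregman_def)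
  have "\<bar>mirror P (a + r *\<^sub>R (c - a)) - mirror P a\<bar>
      \<le> \<bar>r * (mirror P c - mirror P a)\<bar> + \<bar>r * (mirror_grad P a \<bullet> (c - a))\<bar>"
    using up low by linarith
  then show ?thesis
    using r by (simp add: abs_mult distrib_left)
qed

text \<open>Divide \<open>cost_difference\<close> by the step. All increments are of the order of
  the step uniformly in \<open>t\<close>, because states depend on controls in a Lipschitz way, so a
  constant dominates the integrands. The terminal remainder is of smaller order.\<close>

lemma cost_has_directional_derivative:
  assumes u: "u \<in> controls P" and v: "v \<in> controls P"
  shows "((\<lambda>\<epsilon>. (cost P \<tau> (\<lambda>t. u t + \<epsilon> *\<^sub>R (v t - u t)) - cost P \<tau> u) / \<epsilon>) \<longlongrightarrow>
    - integral {0..T} (\<lambda>t. ham_grad u t \<bullet> (v t - u t))) (at_right 0)"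
proof (rule tendsto_at_right_sequentially[where b = 1])
  \<comment> \<open>Dominated convergence concerns sequences, so the one-sided limit is tested along
    sequences. Steps below 1 keep the perturbed controls on the segment from \<open>u\<close> to
    \<open>v\<close>.\<close>
  fix e :: "nat \<Rightarrow> real"
  assume e: "\<And>n. 0 < e n" "\<And>n. e n < 1" "e \<longlonglongrightarrow> 0"
  define V where "V n t = u t + e n *\<^sub>R (v t - u t)" for n t
  have V: "V n \<in> controls P" for n
    unfolding V_def using e(1,2)[of n] by (intro controls_segment u v) auto
  let ?x = "state P u" and ?p = "costate P u"
  obtain K where K: "K \<ge> 0" "\<And>t. t \<in> {0..T} \<Longrightarrow> norm (v t - u t) \<le> K"
  proof (rule continuous_on_interval_bounded)
    show "continuous_on {0..T} (\<lambda>t. v t - u t)"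
      by (intro continuous_intros controlsD u v)
  qed blast
  obtain Kp where Kp: "Kp \<ge> 0" "\<And>t. t \<in> {0..T} \<Longrightarrow> norm (?p t) \<le> Kp"
    by (rule continuous_on_interval_bounded[OF continuous_on_costate[OF u]]) blast
  obtain Kx where Kx: "Kx \<ge> 0" "\<And>t. t \<in> {0..T} \<Longrightarrow> norm (ham0_x P t (?x t) (?p t) (u t)) \<le> Kx"
    by (rule continuous_on_interval_bounded[OF continuous_on_ham0_x[OF continuous_on_state[OF u] u
      continuous_on_costate[OF u]]]) blast
  obtain Kh where Kh: "Kh \<ge> 0" "\<And>t. t \<in> {0..T} \<Longrightarrow>
      norm (\<bar>mirror P (v t) - mirror P (u t)\<bar> + \<bar>mirror_grad P (u t) \<bullet> (v t - u t)\<bar>) \<le> Kh"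
  proof (rule continuous_on_interval_bounded)
    show "continuous_on {0..T} (\<lambda>t. \<bar>mirror P (v t) - mirror P (u t)\<bar> + \<bar>mirror_grad P (u t) \<bullet> (v t - u t)\<bar>)"
      by (intro continuous_intros continuous_on_mirror continuous_on_mirror_grad controlsD u v)
  qed blast
  \<comment> \<open>\<open>c\<close> is the Lipschitz constant of the control-to-state map times the
    bound \<open>K\<close> on the direction; it measures how fast the perturbed states move with the
    step.\<close>
  define c where "c = sqrt (M * T * exp (3 * M * T)) * K"
  have Vu: "norm (V n t - u t) \<le> K * e n" if "t \<in> {0..T}" for n t
    using K(2)[OF that] e(1)[of n] by (simp add: V_def mult.commute)
  have st: "norm (state P (V n) t - ?x t) \<le> c * e n" if "t \<in> {0..T}" for n t
    using state_lipschitz[OF u V, of "K * e n" n t] Vu e(1)[of n] K(1) that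
    by (simp add: c_def mult_ac)
  define G where "G n t = (\<tau> * (mirror P (V n t) - mirror P (u t)) - ham_rem u (V n) t) / e n" for n t
  have G_cont: "continuous_on {0..T} (G n)" for n
    unfolding G_def using e(1)[of n]
    by (intro continuous_intros continuous_on_mirror continuous_on_ham_rem u V) auto
  have "(\<lambda>n. integral {0..T} (G n)) \<longlonglongrightarrow> integral {0..T} (\<lambda>t. - (ham_grad u t \<bullet> (v t - u t)))"
  proof (rule dominated_convergence(2))
    show "G n integrable_on {0..T}" for n
      by (rule integrable_continuous_real[OF G_cont])
    show "(\<lambda>t. \<tau> * Kh + ((Kp + 1) * (M * (c + K)) + Kx * c)) integrable_on {0..T}"
      by (rule integrable_const_ivl)
  next
    fix n t assume t: "t \<in> {0..T}"
    note in_U = controlsD(2)[OF u t] controlsD(2)[OF v t] controlsD(2)[OF V[of n] t]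
    have "\<bar>mirror P (V n t) - mirror P (u t)\<bar>
        \<le> e n * (\<bar>mirror P (v t) - mirror P (u t)\<bar> + \<bar>mirror_grad P (u t) \<bullet> (v t - u t)\<bar>)"
      unfolding V_def using e(1,2)[of n] by (intro mirror_segment_bound in_U) auto
    also have "\<dots> \<le> e n * Kh"
      using Kh(2)[OF t] e(1)[of n] by (intro mult_left_mono) auto
    finally have 1: "\<bar>\<tau> * (mirror P (V n t) - mirror P (u t))\<bar> \<le> \<tau> * (e n * Kh)"
      using \<tau>_nonneg by (simp add: abs_mult mult_left_mono)
    have "\<bar>ham0 P t (state P (V n) t) (?p t) (V n t) - ham0 P t (?x t) (?p t) (u t)\<bar>
        \<le> (norm (?p t) + 1) * (M * (norm (state P (V n) t - ?x t) + norm (V n t - u t)))"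
      by (intro ham0_lipschitz t in_U)
    also have "\<dots> \<le> (Kp + 1) * (M * (c * e n + K * e n))"
      using st[OF t, of n] Vu[OF t, of n] Kp M_pos t by (intro mult_mono add_mono) auto
    finally have 2: "\<bar>ham0 P t (state P (V n) t) (?p t) (V n t) - ham0 P t (?x t) (?p t) (u t)\<bar>
        \<le> (Kp + 1) * (M * (c * e n + K * e n))" .
    have "\<bar>ham0_x P t (?x t) (?p t) (u t) \<bullet> (state P (V n) t - ?x t)\<bar>
        \<le> norm (ham0_x P t (?x t) (?p t) (u t)) * norm (state P (V n) t - ?x t)"
      by (rule Cauchy_Schwarz_ineq2)
    also have "\<dots> \<le> Kx * (c * e n)"
      using st[OF t, of n] Kx t by (intro mult_mono) auto
    finally have 3: "\<bar>ham0_x P t (?x t) (?p t) (u t) \<bullet> (state P (V n) t - ?x t)\<bar> \<le> Kx * (c * e n)" .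
    have "\<bar>\<tau> * (mirror P (V n t) - mirror P (u t)) - ham_rem u (V n) t\<bar>
        \<le> \<tau> * (e n * Kh) + ((Kp + 1) * (M * (c * e n + K * e n)) + Kx * (c * e n))"
      unfolding ham_rem_def using 1 2 3 by linarith
    also have "\<dots> = (\<tau> * Kh + ((Kp + 1) * (M * (c + K)) + Kx * c)) * e n"
      by (simp add: algebra_simps)
    finally show "norm (G n t) \<le> \<tau> * Kh + ((Kp + 1) * (M * (c + K)) + Kx * c)"
      unfolding G_def using e(1)[of n] by (simp add: pos_divide_le_eq)
  next
    fix t assume t: "t \<in> {0..T}"
    note in_U = controlsD(2)[OF u t] controlsD(2)[OF v t] controlsD(2)[OF V t]
    define q where "q = ham_u P 0 t (?x t) (?p t) (u t)"
    let ?F = "\<lambda>(x, w). ham0 P t x (?p t) w"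
    let ?D = "\<lambda>(k, l). ham0_x P t (?x t) (?p t) (u t) \<bullet> k + q \<bullet> l"
    have "(\<lambda>n. (?F (state P (V n) t, V n t) - ?F (?x t, u t)
        - ?D ((state P (V n) t, V n t) - (?x t, u t))) / e n) \<longlonglongrightarrow> 0"
    proof (rule derivative_remainder_quotient[where C = "c + K", OF _ _ _ e(1) e(3)])
      show "(?F has_derivative ?D) (at (?x t, u t) within UNIV \<times> U)"
        unfolding q_def by (rule ham0_deriv[OF t in_U(1)])
      show "norm ((state P (V n) t, V n t) - (?x t, u t)) \<le> (c + K) * e n" for n
        using norm_Pair_le[of "state P (V n) t - ?x t" "V n t - u t"] st[OF t, of n] Vu[OF t, of n]
        by (simp add: distrib_right)
    qed (use in_U in auto)
    \<comment> \<open>The state part of \<open>?D\<close> is exactly what \<open>ham_rem\<close>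
      already subtracts. Only the control part remains, and it is linear in the step.\<close>
    moreover have "(?F (state P (V n) t, V n t) - ?F (?x t, u t)
        - ?D ((state P (V n) t, V n t) - (?x t, u t))) / e n = ham_rem u (V n) t / e n - q \<bullet> (v t - u t)" for n
      using e(1)[of n] by (simp add: ham_rem_def V_def diff_divide_distrib add_divide_distrib)
    ultimately have ham: "(\<lambda>n. ham_rem u (V n) t / e n) \<longlonglongrightarrow> q \<bullet> (v t - u t)"
      by (simp add: LIM_zero_iff)
    have "filterlim e (at_right 0) sequentially"
      using e less_imp_neq[OF e(1)] by (auto simp: filterlim_at)
    from filterlim_compose[OF tendsto_segment_quotient[OF U_convex in_U(1) in_U(2) mirror_deriv[OF in_U(1)]] this]
    have "(\<lambda>n. (mirror P (V n t) - mirror P (u t)) / e n) \<longlonglongrightarrow> mirror_grad P (u t) \<bullet> (v t - u t)"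
      by (simp add: V_def divide_inverse_commute)
    then have "(\<lambda>n. \<tau> * ((mirror P (V n t) - mirror P (u t)) / e n) - ham_rem u (V n) t / e n)
        \<longlonglongrightarrow> \<tau> * (mirror_grad P (u t) \<bullet> (v t - u t)) - q \<bullet> (v t - u t)"
      by (intro tendsto_intros ham)
    moreover have "\<tau> * (mirror_grad P (u t) \<bullet> (v t - u t)) - q \<bullet> (v t - u t) = - (ham_grad u t \<bullet> (v t - u t))"
      by (simp add: q_def ham_grad_def ham_u_def inner_diff_left)
    moreover have "G n t = \<tau> * ((mirror P (V n t) - mirror P (u t)) / e n) - ham_rem u (V n) t / e n" for n
      by (simp only: G_def diff_divide_distrib[of "\<tau> * _"] times_divide_eq_right)
    ultimately show "(\<lambda>n. G n t) \<longlonglongrightarrow> - (ham_grad u t \<bullet> (v t - u t))"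
      by simp
  qed
  moreover have "(\<lambda>n. (tcost P (state P (V n) T) - tcost P (?x T)
      - tcost_grad P (?x T) \<bullet> (state P (V n) T - ?x T)) / e n) \<longlonglongrightarrow> 0"
    using T_pos by (intro derivative_remainder_quotient[where C = c, OF tcost_deriv _ _ e(1) e(3)] st) auto
  ultimately have "(\<lambda>n. tcost_rem u (V n) / e n + integral {0..T} (G n)) \<longlonglongrightarrow>
      0 + integral {0..T} (\<lambda>t. - (ham_grad u t \<bullet> (v t - u t)))"
    unfolding tcost_rem_def by (intro tendsto_add)
  moreover have "(cost P \<tau> (V n) - cost P \<tau> u) / e n = tcost_rem u (V n) / e n + integral {0..T} (G n)" for n
    unfolding cost_difference[OF u V] G_def by (simp add: add_divide_distrib)
  ultimately show "(\<lambda>n. (cost P \<tau> (\<lambda>t. u t + e n *\<^sub>R (v t - u t)) - cost P \<tau> u) / e n) \<longlonglongrightarrow>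
      - integral {0..T} (\<lambda>t. ham_grad u t \<bullet> (v t - u t))"
    by (simp add: V_def[abs_def])
qed simp

lemma dir_deriv_eq:
  assumes "u \<in> controls P" "v \<in> controls P"
  shows "dir_deriv P \<tau> u v = - integral {0..T} (\<lambda>t. ham_grad u t \<bullet> (v t - u t))"
  unfolding dir_deriv_def
  by (intro tendsto_Lim cost_has_directional_derivative assms) simp

section \<open>Integrated divergence and convexity of the cost relative to it\<close>

lemma int_bregman_nonneg:
  assumes "u \<in> controls P" "v \<in> controls P"
  shows "0 \<le> int_bregman P v u"
  unfolding int_bregman_def
  by (intro integral_nonneg integrable_continuous_real continuous_on_bregman bregman_nonneg controlsD assms)

lemma int_bregman_refl [simp]: "int_bregman P u u = 0"
  by (simp add: int_bregman_def bregman_def)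

text \<open>Concavity bounds \<open>ham_rem u v t\<close> by the control part of the gradient of
  \<open>ham0\<close>, which is \<open>ham_grad u t\<close> plus \<open>\<tau>\<close> times
  \<open>mirror_grad P (u t)\<close>. The mirror part combines with the increment of
  \<open>mirror P\<close> into \<open>\<tau>\<close> times the divergence, and convexity of the
  terminal cost makes \<open>tcost_rem\<close> nonnegative.\<close>

lemma relative_convexity:
  assumes g: "convex_on UNIV (tcost P)"
    and conc: "\<And>t p. t \<in> {0..T} \<Longrightarrow> concave_on (UNIV \<times> U) (\<lambda>(x, w). ham0 P t x p w)"
    and u: "u \<in> controls P" and v: "v \<in> controls P"
  shows "\<tau> * int_bregman P v u - integral {0..T} (\<lambda>t. ham_grad u t \<bullet> (v t - u t))
    \<le> cost P \<tau> v - cost P \<tau> u"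
proof -
  have "- tcost P (state P v T) - - tcost P (state P u T)
      \<le> - (tcost_grad P (state P u T) \<bullet> (state P v T - state P u T))"
    using g by (intro concave_on_le_gradient[where S = UNIV] has_derivative_minus tcost_deriv)
      (auto simp: concave_on_def)
  then have 1: "0 \<le> tcost_rem u v"
    by (simp add: tcost_rem_def)
  have "ham_rem u v t \<le> \<tau> * (mirror_grad P (u t) \<bullet> (v t - u t)) + ham_grad u t \<bullet> (v t - u t)"
    if t: "t \<in> {0..T}" for t
    using concave_on_le_gradient[OF conc[OF t, of "costate P u t"] 
        ham0_deriv[OF t controlsD(2)[OF u t], of "costate P u t" "state P u t"], of "(state P v t, v t)"] controlsD(2)[OF u t] controlsD(2)[OF v t]
    by (simp add: ham_rem_def ham_grad_def ham_u_def inner_diff_left)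
  then have pt: "\<tau> * bregman P (v t) (u t) - ham_grad u t \<bullet> (v t - u t)
      \<le> \<tau> * (mirror P (v t) - mirror P (u t)) - ham_rem u v t" if "t \<in> {0..T}" for t
    using that by (fastforce simp: bregman_def right_diff_distrib)
  have "\<tau> * int_bregman P v u - integral {0..T} (\<lambda>t. ham_grad u t \<bullet> (v t - u t)) =
      integral {0..T} (\<lambda>t. \<tau> * bregman P (v t) (u t) - ham_grad u t \<bullet> (v t - u t))"
    unfolding int_bregman_def
    by (subst integral_diff) (auto intro!: integrable_continuous_real continuous_intros
        continuous_on_bregman continuous_on_ham_grad u v)
  also have "\<dots> \<le> integral {0..T} (\<lambda>t. \<tau> * (mirror P (v t) - mirror P (u t)) - ham_rem u v t)"
    by (intro integral_le integrable_continuous_real continuous_intros continuous_on_bregman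
        continuous_on_ham_grad continuous_on_mirror continuous_on_ham_rem pt u v)
  finally show ?thesis
    using 1 cost_difference[OF u v] by simp
qed

section \<open>The mirror descent step\<close>

text \<open>At a maximiser over a convex set the one-sided derivative towards any feasible point is
  nonpositive. Differentiating the divergence in its first argument gives the difference of mirror
  gradients.\<close>

lemma argmax_first_order:
  assumes a: "a \<in> U" and c: "c \<in> U"
    and w: "is_arg_max (\<lambda>v. q \<bullet> (v - a) - lam * bregman P v a) (\<lambda>v. v \<in> U) w"
  shows "(q - lam *\<^sub>R (mirror_grad P w - mirror_grad P a)) \<bullet> (c - w) \<le> 0"
proof -
  define F where "F v = q \<bullet> (v - a) - lam * bregman P v a" for v
  define D where "D k = q \<bullet> k - lam * (mirror_grad P w \<bullet> k - mirror_grad P a \<bullet> k)" for k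
  have wU: "w \<in> U" and max: "\<And>v. v \<in> U \<Longrightarrow> F v \<le> F w"
    using w by (auto simp: is_arg_max_linorder F_def)
  have "(F has_derivative D) (at w within U)"
    unfolding F_def[abs_def] D_def[abs_def] bregman_def
    by (auto intro!: derivative_eq_intros mirror_deriv[OF wU] simp: inner_diff_left)
  then have "((\<lambda>r. (F (w + r *\<^sub>R (c - w)) - F w) /\<^sub>R r) \<longlongrightarrow> D (c - w)) (at_right 0)"
    by (rule tendsto_segment_quotient[OF U_convex wU c])
  moreover have "\<forall>\<^sub>F r in at_right 0. (F (w + r *\<^sub>R (c - w)) - F w) /\<^sub>R r \<le> 0"
    unfolding eventually_at_right_field
  proof (intro exI[of _ 1] conjI allI impI)
    fix r :: real assume r: "0 < r" "r < 1"
    have "w + r *\<^sub>R (c - w) \<in> U"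
      unfolding convex_comb_eq using r wU c by (intro convexD_alt U_convex) auto
    from max[OF this] r show "(F (w + r *\<^sub>R (c - w)) - F w) /\<^sub>R r \<le> 0"
      by (simp add: mult_nonneg_nonpos)
  qed simp
  ultimately have "D (c - w) \<le> 0"
    by (rule tendsto_upperbound) simp
  then show ?thesis
    by (simp add: D_def inner_diff_left)
qed

text \<open>For the divergence, D(c|a) - D(c|w) - D(w|a) equals the difference of the mirror
  gradients at \<open>w\<close> and \<open>a\<close> paired with \<open>c - w\<close>. The gap
  between the two sides is therefore exactly the first-order expression with its sign
  reversed.\<close>

lemma argmax_three_point:
  assumes a: "a \<in> U" and c: "c \<in> U"
    and w: "is_arg_max (\<lambda>v. q \<bullet> (v - a) - lam * bregman P v a) (\<lambda>v. v \<in> U) w"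
  shows "lam * bregman P w a - q \<bullet> (w - a)
    \<le> lam * bregman P c a - lam * bregman P c w - q \<bullet> (c - a)"
proof -
  have "lam * bregman P c a - lam * bregman P c w - q \<bullet> (c - a) - (lam * bregman P w a - q \<bullet> (w - a))
      = - ((q - lam *\<^sub>R (mirror_grad P w - mirror_grad P a)) \<bullet> (c - w))"
    by (simp add: bregman_def inner_diff_left inner_diff_right algebra_simps)
  then show ?thesis
    using argmax_first_order[OF a c w] by linarith
qed

text \<open>Uniform convexity, added up with the two points exchanged, makes
  \<open>mirror_grad\<close> strongly monotone. Comparing the first-order conditions at two times
  then bounds the displacement of the maximiser by that of a continuous function of time.\<close>

lemma argmax_control:
  assumes \<sigma>: "\<sigma> > 0" and lam: "lam > 0"
    and unif: "\<And>w v. w \<in> U \<Longrightarrow> v \<in> U \<Longrightarrow> bregman P v w \<ge> \<sigma> / 2 * (norm (v - w))\<^sup>2"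
    and u: "u \<in> controls P"
    and w: "\<And>t. t \<in> {0..T} \<Longrightarrow> is_arg_max
      (\<lambda>v. ham_grad u t \<bullet> (v - u t) - lam * bregman P v (u t)) (\<lambda>v. v \<in> U) (w t)"
  shows "w \<in> controls P"
proof -
  have wU: "w t \<in> U" if "t \<in> {0..T}" for t
    using w[OF that] by (simp add: is_arg_max_linorder)
  \<comment> \<open>Displacements of the maximiser lie in the span of these differences. An
    orthonormal basis of it isolates the part of \<open>ham_grad\<close> that the first-order
    conditions see.\<close>
  define A where "A = {a - c | a c. a \<in> U \<and> c \<in> U}"
  obtain B where B: "B \<subseteq> span A" "pairwise orthogonal B" "\<And>b. b \<in> B \<Longrightarrow> norm b = 1"
    "independent B" "span B = span A"
    using orthonormal_basis_subspace[OF subspace_span[of A]] by metis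
  have finB: "finite B"
    using B(4) by (rule independent_imp_finite)
  have const: "(\<lambda>_. a) \<in> controls P" if "a \<in> U" for a
    using that by (simp add: controls_def)
  have q_cont: "continuous_on {0..T} (\<lambda>t. ham_grad u t \<bullet> b)" if "b \<in> span A" for b
    using that
  proof (induction rule: span_induct)
    show "subspace (Collect (\<lambda>b. continuous_on {0..T} (\<lambda>t. ham_grad u t \<bullet> b)))"
      by (auto simp: subspace_def inner_add_right intro!: continuous_intros)
    fix b assume "b \<in> A"
    then obtain a c where ac: "a \<in> U" "c \<in> U" "b = a - c"
      by (auto simp: A_def)
    \<comment> \<open>\<open>a - c\<close> may fail to be feasible at \<open>u t\<close>, but it is
      the difference of two feasible directions there.\<close>
    have "continuous_on {0..T} (\<lambda>t. ham_grad u t \<bullet> (a - u t) - ham_grad u t \<bullet> (c - u t))"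
      by (intro continuous_intros continuous_on_ham_grad u const ac)
    then show "continuous_on {0..T} (\<lambda>t. ham_grad u t \<bullet> b)"
      by (simp add: ac inner_diff_right)
  qed
  \<comment> \<open>\<open>ham_grad u\<close> itself need not be continuous, but its projection to the span of \<open>U - U\<close> is.\<close>
  define \<psi> where "\<psi> t = (\<Sum>b\<in>B. (ham_grad u t \<bullet> b) *\<^sub>R b) + lam *\<^sub>R mirror_grad P (u t)" for t
  have "continuous_on {0..T} \<psi>"
    unfolding \<psi>_def using B(1)
    by (intro continuous_on_add continuous_on_sum continuous_on_scaleR q_cont continuous_on_const
        continuous_on_mirror_grad u) auto
  moreover have lip: "lam * \<sigma> * dist (w s) (w t) \<le> dist (\<psi> s) (\<psi> t)"
    if s: "s \<in> {0..T}" and t: "t \<in> {0..T}" for s t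
  proof -
    define d where "d = w s - w t"
    note us = controlsD(2)[OF u s] and ut = controlsD(2)[OF u t]
    have "d \<in> span B"
      unfolding B(5) d_def A_def using wU[OF s] wU[OF t] by (intro span_base) auto
    then have d: "d = (\<Sum>b\<in>B. (d \<bullet> b) *\<^sub>R b)"
      using orthonormal_basis_expand[OF B(2,3)] finB by force
    have proj: "(\<Sum>b\<in>B. (x \<bullet> b) *\<^sub>R b) \<bullet> d = x \<bullet> d" for x
    proof -
      have "x \<bullet> d = (\<Sum>b\<in>B. (d \<bullet> b) * (x \<bullet> b))"
        by (subst d) (simp add: inner_sum_right)
      also have "\<dots> = (\<Sum>b\<in>B. (x \<bullet> b) *\<^sub>R b) \<bullet> d"
        unfolding inner_sum_left by (simp add: inner_commute mult.commute)
      finally show ?thesis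
        by simp
    qed
    have "\<sigma> * (norm d)\<^sup>2 \<le> bregman P (w s) (w t) + bregman P (w t) (w s)"
      using unif[OF wU[OF s] wU[OF t]] unif[OF wU[OF t] wU[OF s]]
      by (simp add: d_def norm_minus_commute)
    also have "\<dots> = (mirror_grad P (w s) - mirror_grad P (w t)) \<bullet> d"
      by (simp add: bregman_def d_def inner_diff_left inner_diff_right)
    finally have "lam * (\<sigma> * (norm d)\<^sup>2) \<le> lam * ((mirror_grad P (w s) - mirror_grad P (w t)) \<bullet> d)"
      using lam by simp
    \<comment> \<open>The condition at \<open>s\<close> is tested with \<open>w t\<close> and the
      one at \<open>t\<close> with \<open>w s\<close>. Their sum contains \<open>ham_grad\<close>
      only paired with \<open>d\<close>, where \<open>proj\<close> lets its projection take its
      place.\<close>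
    also have "\<dots> \<le> (\<psi> s - \<psi> t) \<bullet> d"
      using argmax_first_order[OF us wU[OF t] w[OF s]] argmax_first_order[OF ut wU[OF s] w[OF t]]
      unfolding \<psi>_def inner_diff_left inner_add_left proj
      by (simp add: d_def inner_diff_left inner_diff_right algebra_simps)
    also have "\<dots> \<le> norm (\<psi> s - \<psi> t) * norm d"
      by (rule norm_cauchy_schwarz)
    finally have "(lam * \<sigma> * norm d) * norm d \<le> norm (\<psi> s - \<psi> t) * norm d"
      by (simp add: power2_eq_square mult_ac)
    then show ?thesis
      by (cases "norm d = 0") (auto simp: dist_norm d_def dest: mult_right_le_imp_le)
  qed
  have "continuous_on {0..T} w"
    unfolding continuous_on_iff
  proof (intro ballI allI impI)
    fix t e :: real assume t: "t \<in> {0..T}" and e: "e > 0"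
    have "lam * \<sigma> * e > 0"
      using lam \<sigma> e by simp
    with \<open>continuous_on {0..T} \<psi>\<close> t obtain \<delta> where \<delta>: "\<delta> > 0"
      "\<And>s. s \<in> {0..T} \<Longrightarrow> dist s t < \<delta> \<Longrightarrow> dist (\<psi> s) (\<psi> t) < lam * \<sigma> * e"
      unfolding continuous_on_iff by meson
    have "dist (w s) (w t) < e" if "s \<in> {0..T}" "dist s t < \<delta>" for s
    proof -
      have "lam * \<sigma> * dist (w s) (w t) < lam * \<sigma> * e"
        using lip[OF that(1) t] \<delta>(2)[OF that] by linarith
      then show ?thesis
        using lam \<sigma> by simp
    qed
    with \<delta>(1) show "\<exists>\<delta>>0. \<forall>s\<in>{0..T}. dist s t < \<delta> \<longrightarrow> dist (w s) (w t) < e"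
      by blast
  qed
  with wU show ?thesis
    by (simp add: controls_def)
qed

lemma mirror_descent_controls:
  assumes \<sigma>: "\<sigma> > 0" and lam: "lam > 0"
    and unif: "\<And>w v. w \<in> U \<Longrightarrow> v \<in> U \<Longrightarrow> bregman P v w \<ge> \<sigma> / 2 * (norm (v - w))\<^sup>2"
    and u0: "u0 \<in> controls P" and iter: "mirror_descent P \<tau> lam u0 u"
  shows "u n \<in> controls P"
proof (induction n)
  case 0
  then show ?case
    using u0 iter by (simp add: mirror_descent_def)
next
  case (Suc n)
  show ?case
    using iter by (intro argmax_control[OF \<sigma> lam unif Suc]) (auto simp: mirror_descent_def ham_grad_def)
qed

text \<open>The cost of \<open>u\<close> cancels: smoothness bounds the cost of \<open>u'\<close>
  relative to it, and relative convexity bounds the linear term in \<open>v\<close> by the cost of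
  \<open>v\<close> relative to it. The integrated three-point inequality links the two linear
  terms.\<close>

lemma mirror_descent_step:
  assumes smooth: "relatively_smooth P \<tau> L" and L: "L \<le> lam"
    and g: "convex_on UNIV (tcost P)"
    and conc: "\<And>t p. t \<in> {0..T} \<Longrightarrow> concave_on (UNIV \<times> U) (\<lambda>(x, w). ham0 P t x p w)"
    and u: "u \<in> controls P" and u': "u' \<in> controls P" and v: "v \<in> controls P"
    and max: "\<And>t. t \<in> {0..T} \<Longrightarrow> is_arg_max
      (\<lambda>w. ham_grad u t \<bullet> (w - u t) - lam * bregman P w (u t)) (\<lambda>w. w \<in> U) (u' t)"
  shows "cost P \<tau> u' - cost P \<tau> v \<le> (lam - \<tau>) * int_bregman P v u - lam * int_bregman P v u'"
proof -
  let ?I = "\<lambda>w. integral {0..T} (\<lambda>t. ham_grad u t \<bullet> (w t - u t))"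
  have cont: "continuous_on {0..T} (\<lambda>t. ham_grad u t \<bullet> (w t - u t))"
    "continuous_on {0..T} (\<lambda>t. lam * bregman P (w t) (u t))" if "w \<in> controls P" for w
    by (intro continuous_intros continuous_on_ham_grad continuous_on_bregman u that)+
  have cont': "continuous_on {0..T} (\<lambda>t. lam * bregman P (v t) (u' t))"
    by (intro continuous_intros continuous_on_bregman u' v)
  have "cost P \<tau> u' - cost P \<tau> u \<le> L * int_bregman P u' u - ?I u'"
    using smooth u u' by (force simp: relatively_smooth_def dir_deriv_eq)
  also have "\<dots> \<le> lam * int_bregman P u' u - ?I u'"
    using L int_bregman_nonneg[OF u u'] by (simp add: mult_right_mono)
  also have "\<dots> = integral {0..T} (\<lambda>t. lam * bregman P (u' t) (u t) - ham_grad u t \<bullet> (u' t - u t))"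
    unfolding int_bregman_def
    by (simp add: integral_diff integrable_continuous_real cont[OF u'])
  also have "\<dots> \<le> integral {0..T} (\<lambda>t. lam * bregman P (v t) (u t) - lam * bregman P (v t) (u' t)
      - ham_grad u t \<bullet> (v t - u t))"
    by (intro integral_le integrable_continuous_real continuous_on_diff cont cont' u' v
        argmax_three_point controlsD(2)[OF u] controlsD(2)[OF v] max)
  also have "\<dots> = lam * int_bregman P v u - lam * int_bregman P v u' - ?I v"
    unfolding int_bregman_def
    by (simp add: integral_diff integrable_diff integrable_continuous_real cont[OF v] cont')
  also have "\<dots> \<le> lam * int_bregman P v u - lam * int_bregman P v u'
      + (cost P \<tau> v - cost P \<tau> u - \<tau> * int_bregman P v u)"
    using relative_convexity[OF g conc u v] by simp
  finally show ?thesis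
    by (simp add: algebra_simps)
qed

end

section \<open>Real recursions behind the sublinear and the linear rate\<close>

lemma average_bound:
  fixes c D :: "nat \<Rightarrow> real"
  assumes lam: "lam \<ge> 0" and D: "\<And>n. D n \<ge> 0" and mono: "\<And>n. c (Suc n) \<le> c n"
    and step: "\<And>n. c (Suc n) \<le> lam * D n - lam * D (Suc n)" and n: "n \<ge> 1"
  shows "c n \<le> lam / real n * D 0"
proof -
  \<comment> \<open>The divergences telescope in the sum of \<open>c 1\<close> to
    \<open>c n\<close>. Monotonicity makes the last gap at most the average.\<close>
  have "real n * c n \<le> lam * D 0 - lam * D n" for n
  proof (induction n)
    case (Suc n)
    have "real n * c (Suc n) \<le> real n * c n"
      using mono by (intro mult_left_mono) auto
    then have "real (Suc n) * c (Suc n) \<le> real n * c n + c (Suc n)"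
      by (simp add: algebra_simps)
    with Suc step[of n] show ?case
      by linarith
  qed simp
  moreover have "0 \<le> lam * D n"
    using lam D by simp
  ultimately have "real n * c n \<le> lam * D 0"
    by (smt (verit))
  then show ?thesis
    using n by (simp add: field_simps)
qed

lemma linear_rate_bound:
  fixes c D :: "nat \<Rightarrow> real"
  assumes lam: "lam > 0" and \<tau>: "\<tau> > 0" and D: "\<And>n. D n \<ge> 0" and c: "\<And>n. c n \<ge> 0"
    and step: "\<And>n. c (Suc n) \<le> (lam - \<tau>) * D n - lam * D (Suc n)" and n: "n \<ge> 1"
  shows "c n \<le> lam * (1 - \<tau> / lam) ^ (n - 1) * D 0"
proof (cases "\<tau> \<le> lam")
  case True
  then have r: "0 \<le> 1 - \<tau> / lam"
    using lam by simp
  have eq: "lam - \<tau> = lam * (1 - \<tau> / lam)"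
    using lam by (simp add: field_simps)
  have D_le: "D n \<le> (1 - \<tau> / lam) ^ n * D 0" for n
  proof (induction n)
    case (Suc n)
    have "lam * D (Suc n) \<le> lam * ((1 - \<tau> / lam) * D n)"
      using step[of n] c[of "Suc n"] by (simp add: eq mult.assoc)
    then have "D (Suc n) \<le> (1 - \<tau> / lam) * D n"
      using lam by simp
    also have "\<dots> \<le> (1 - \<tau> / lam) * ((1 - \<tau> / lam) ^ n * D 0)"
      using Suc r by (rule mult_left_mono)
    finally show ?case
      by (simp add: mult.assoc)
  qed simp
  obtain m where m: "n = Suc m"
    using n by (cases n) auto
  have "c n \<le> (lam - \<tau>) * D m"
    using step[of m] D[of "Suc m"] lam m by (smt (verit) mult_nonneg_nonneg)
  also have "\<dots> \<le> lam * D m"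
    using D[of m] \<tau> by (intro mult_right_mono) auto
  also have "\<dots> \<le> lam * ((1 - \<tau> / lam) ^ m * D 0)"
    using lam D_le by simp
  finally show ?thesis
    by (simp add: m mult.assoc)
next
  case False
  \<comment> \<open>If \<open>\<tau> > lam\<close> the recursion forces all divergences to vanish.\<close>
  have D0: "D n = 0" for n
  proof -
    have "0 \<le> (lam - \<tau>) * D n"
      using step[of n] c[of "Suc n"] D[of "Suc n"] lam by (smt (verit) mult_nonneg_nonneg)
    then show ?thesis
      using False D[of n] by (smt (verit) mult_neg_pos)
  qed
  obtain m where "n = Suc m"
    using n by (cases n) auto
  then show ?thesis
    using step[of m] by (simp add: D0)
qed

theorem theorem5:
  fixes P :: "('d::finite, 'm::finite) control_problem"
    and \<tau> M Mbuu Mfuu \<sigma> L lam :: real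
    and u0 :: "real \<Rightarrow> real^'m"
    and u :: "nat \<Rightarrow> real \<Rightarrow> real^'m"
  assumes standing: "standing_assumptions P \<tau> M Mbuu Mfuu"
    and sigma_pos: "\<sigma> > 0"
    and uniform_convexity:
      "\<And>w v. w \<in> ctrl_set P \<Longrightarrow> v \<in> ctrl_set P \<Longrightarrow> bregman P v w \<ge> \<sigma> / 2 * (norm (v - w))\<^sup>2"
    and g_convex: "convex_on UNIV (tcost P)"
    and ham_concave:
      "\<And>t p. t \<in> {0..horizon P} \<Longrightarrow>
         concave_on (UNIV \<times> ctrl_set P) (\<lambda>(x, w). ham0 P t x p w)"
    and L_pos: "L > 0"
    and smooth: "relatively_smooth P \<tau> L"
    and lam_ge: "lam \<ge> L"
    and u0: "u0 \<in> controls P"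
    and iterates: "mirror_descent P \<tau> lam u0 u"
  shows
    "(\<tau> = 0 \<longrightarrow>
        (\<forall>v\<in>controls P. (\<forall>n. int_bregman_finite P v (u n)) \<longrightarrow>
           (\<forall>n\<ge>1. cost P 0 (u n) - cost P 0 v \<le> lam / real n * int_bregman P v u0))) \<and>
     (\<tau> > 0 \<longrightarrow>
        (\<forall>w. minimizer P \<tau> w \<longrightarrow>
           (\<forall>n\<ge>1. 0 \<le> cost P \<tau> (u n) - cost P \<tau> w \<and>
              cost P \<tau> (u n) - cost P \<tau> w
                \<le> lam * (1 - \<tau> / lam) ^ (n - 1) * int_bregman P w u0)))"
proof -
  interpret control P \<tau> M Mbuu Mfuu
    using standing by unfold_locales
  have lam: "lam > 0"
    using L_pos lam_ge by simp
  have u: "u n \<in> controls P" for n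
    by (rule mirror_descent_controls[OF sigma_pos lam uniform_convexity u0 iterates])
  have step: "cost P \<tau> (u (Suc n)) - cost P \<tau> v
      \<le> (lam - \<tau>) * int_bregman P v (u n) - lam * int_bregman P v (u (Suc n))"
    if "v \<in> controls P" for n v
    using iterates
    by (intro mirror_descent_step[OF smooth lam_ge g_convex ham_concave u u that])
      (auto simp: mirror_descent_def ham_grad_def)
  \<comment> \<open>Comparing with \<open>v = u n\<close> itself, whose own divergence vanishes,
    gives monotone descent of the cost.\<close>
  have "cost P \<tau> (u (Suc n)) - cost P \<tau> (u n) \<le> - (lam * int_bregman P (u n) (u (Suc n)))" for n
    using step[OF u, of n n] by simp
  moreover have "0 \<le> lam * int_bregman P (u n) (u (Suc n))" for n
    using lam int_bregman_nonneg[OF u u] by simp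
  ultimately have mono: "cost P \<tau> (u (Suc n)) \<le> cost P \<tau> (u n)" for n
    by (smt (verit))
  have u_0: "u 0 = u0"
    using iterates by (simp add: mirror_descent_def)
  have "cost P 0 (u n) - cost P 0 v \<le> lam / real n * int_bregman P v u0"
    if "\<tau> = 0" and v: "v \<in> controls P" and n: "n \<ge> 1" for v n
    using average_bound[of lam "\<lambda>n. int_bregman P v (u n)" "\<lambda>n. cost P \<tau> (u n) - cost P \<tau> v", OF _ _ _ _ n]
      lam int_bregman_nonneg[OF u v] mono step[OF v] \<open>\<tau> = 0\<close>
    by (simp add: u_0)
  moreover have "0 \<le> cost P \<tau> (u n) - cost P \<tau> w \<and>
      cost P \<tau> (u n) - cost P \<tau> w \<le> lam * (1 - \<tau> / lam) ^ (n - 1) * int_bregman P w u0"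
    if "\<tau> > 0" and w: "minimizer P \<tau> w" and n: "n \<ge> 1" for w n
  proof -
    \<comment> \<open>Minimality makes all gaps nonnegative, the condition under which the recursion
      contracts the divergences.\<close>
    have wc: "w \<in> controls P" and min: "0 \<le> cost P \<tau> (u n) - cost P \<tau> w" for n
      using w u by (auto simp: minimizer_def)
    show ?thesis
      using linear_rate_bound[of lam \<tau> "\<lambda>n. int_bregman P w (u n)" "\<lambda>n. cost P \<tau> (u n) - cost P \<tau> w",
          OF lam \<open>\<tau> > 0\<close> int_bregman_nonneg[OF u wc] min step[OF wc] n] min
      by (simp add: u_0)
  qed
  ultimately show ?thesis
    by blast
qed

end
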